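(* An inverse limit of finitely generated free (equivalently, finitely generated torsion-free) discrete abelian groups need not be reflexive. That is, there exist a directed set $(I,\le)$ and an inverse system $(G_i,p^j_i)_{i\le j\in I}$ of finitely generated free abelian groups $G_i$, each with the discrete topology, and group homomorphisms $p^j_i:G_j\to G_i$, such that the inverse limit $\varprojlim_{i\in I} G_i$ (as a topological group) is not reflexive.
   Context: The inverse limit $\varprojlim_{i\in I}G_i$ is the subgroup $\{(x_i)_{i\in I}\in\prod_{i\in I}G_i : p^j_i(x_j)=x_i \text{ for all } i\le j\}$ with the subspace topology inherited from the Tychonoff product $\prod_{i\in I}G_i$ of discrete groups. $\mathbb{T}=\mathbb{R}/\mathbb{Z}$ is the circle group. For an abelian topological group $H$, the (Pontryagin) dual group $\widehat{H}$ is the group of all continuous homomorphisms $H\to\mathbb{T}$ with pointwise addition, equipped with the compact-open topology. An abelian topological group $H$ is called reflexive if its second Pontryagin dual $\widehat{\widehat{H}}$ is topologically isomorphic to $H$. *)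

theory Defs
  imports "HOL-Analysis.Analysis" "HOL-Algebra.Free_Abelian_Groups"
begin

text \<open>
  A topological group is a pair of a group (HOL-Algebra) and an abstract topology whose
  \<^const>\<open>topspace\<close> is the carrier. All groups here are abelian, written multiplicatively as usual
  in HOL-Algebra.
\<close>

definition real_add_group :: "real monoid" where
  "real_add_group = \<lparr>carrier = UNIV, monoid.mult = (+), one = 0\<rparr>"

definition circle_group :: "real set monoid" where
  "circle_group = real_add_group Mod \<int>"

definition circle_proj :: "real \<Rightarrow> real set" where
  "circle_proj x = \<int> #>\<^bsub>real_add_group\<^esub> x"

definition circle_topology :: "real set topology" where
  "circle_topology =
     topology (\<lambda>U. U \<subseteq> carrier circle_group \<and> open (circle_proj -` U))"

lemma openin_circle_topology:
  "openin circle_topology U \<longleftrightarrow> U \<subseteq> carrier circle_group \<and> open (circle_proj -` U)"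
proof -
  have "istopology (\<lambda>U. U \<subseteq> carrier circle_group \<and> open (circle_proj -` U))"
    unfolding istopology_def by (auto simp: vimage_Union)
  then show ?thesis
    by (simp add: circle_topology_def topology_inverse')
qed

lemma carrier_circle_group: "carrier circle_group = range circle_proj"
  by (auto simp: circle_group_def circle_proj_def carrier_FactGroup real_add_group_def)

lemma topspace_circle_topology: "topspace circle_topology = carrier circle_group"
proof
  show "topspace circle_topology \<subseteq> carrier circle_group"
    using openin_circle_topology openin_topspace by blast
  have "openin circle_topology (carrier circle_group)"
    by (simp add: openin_circle_topology carrier_circle_group vimage_def)
  then show "carrier circle_group \<subseteq> topspace circle_topology"
    by (rule openin_subset)
qed

lemma quotient_map_circle_proj: "quotient_map euclideanreal circle_topology circle_proj"
  by (auto simp: quotient_map_def topspace_circle_topology carrier_circle_group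
      openin_circle_topology vimage_def)

text \<open>Characters are taken in \<^const>\<open>extensional\<close> form, so that each of them is represented by
  exactly one HOL function.\<close>

definition dual_group :: "('a, 'c) monoid_scheme \<Rightarrow> 'a topology \<Rightarrow> ('a \<Rightarrow> real set) monoid" where
  "dual_group H T =
     \<lparr>carrier = {f \<in> hom H circle_group \<inter> extensional (carrier H).
                   continuous_map T circle_topology f},
      monoid.mult = (\<lambda>f g. \<lambda>x\<in>carrier H. f x \<otimes>\<^bsub>circle_group\<^esub> g x),
      one = (\<lambda>x\<in>carrier H. \<one>\<^bsub>circle_group\<^esub>)\<rparr>"

definition dual_topology :: "('a, 'c) monoid_scheme \<Rightarrow> 'a topology \<Rightarrow> ('a \<Rightarrow> real set) topology" where
  "dual_topology H T =
     topology_generated_by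
       {{f \<in> carrier (dual_group H T). f ` K \<subseteq> U} | K U. compactin T K \<and> openin circle_topology U}"

lemma topspace_dual_topology: "topspace (dual_topology H T) = carrier (dual_group H T)"
proof -
  have "carrier (dual_group H T) \<in>
    {{f \<in> carrier (dual_group H T). f ` K \<subseteq> U} | K U. compactin T K \<and> openin circle_topology U}"
    by (intro CollectI exI[of _ "{}"]) auto
  then show ?thesis
    unfolding dual_topology_def topology_generated_by_topspace by blast
qed

definition topologically_isomorphic ::
  "('a, 'c) monoid_scheme \<Rightarrow> 'a topology \<Rightarrow> ('b, 'd) monoid_scheme \<Rightarrow> 'b topology \<Rightarrow> bool" where
  "topologically_isomorphic G S H T \<longleftrightarrow> (\<exists>f. f \<in> iso G H \<and> homeomorphic_map S T f)"

text \<open>The isomorphism is arbitrary, it need not be the evaluation map.\<close>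

definition reflexive_group :: "('a, 'c) monoid_scheme \<Rightarrow> 'a topology \<Rightarrow> bool" where
  "reflexive_group H T \<longleftrightarrow>
     topologically_isomorphic
       (dual_group (dual_group H T) (dual_topology H T))
       (dual_topology (dual_group H T) (dual_topology H T))
       H T"

definition finitely_generated_group :: "('a, 'c) monoid_scheme \<Rightarrow> bool" where
  "finitely_generated_group G \<longleftrightarrow>
     (\<exists>S. finite S \<and> S \<subseteq> carrier G \<and> generate G S = carrier G)"

text \<open>A basis of \<open>G\<close> is a subset of its carrier, so letting \<open>S\<close> range over
  sets of elements of the same type is no restriction.\<close>

definition free_abelian :: "('a, 'c) monoid_scheme \<Rightarrow> bool" where
  "free_abelian G \<longleftrightarrow> comm_group G \<and> (\<exists>S :: 'a set. G \<cong> free_Abelian_group S)"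

text \<open>The order on the index set is a set of pairs: \<open>(i, j) \<in> r\<close> stands for \<open>i \<le> j\<close>.\<close>

definition directed_set :: "'i set \<Rightarrow> ('i \<times> 'i) set \<Rightarrow> bool" where
  "directed_set I r \<longleftrightarrow>
     I \<noteq> {} \<and> partial_order_on I r \<and> (\<forall>i\<in>I. \<forall>j\<in>I. \<exists>k\<in>I. (i, k) \<in> r \<and> (j, k) \<in> r)"

text \<open>For \<open>i \<le> j\<close> the bonding map from \<open>G j\<close> to \<open>G i\<close> is \<open>p i j\<close>.\<close>

definition inverse_system ::
  "'i set \<Rightarrow> ('i \<times> 'i) set \<Rightarrow> ('i \<Rightarrow> ('a, 'c) monoid_scheme) \<Rightarrow> ('i \<Rightarrow> 'i \<Rightarrow> 'a \<Rightarrow> 'a) \<Rightarrow> bool" where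
  "inverse_system I r G p \<longleftrightarrow>
     directed_set I r \<and>
     (\<forall>i\<in>I. group (G i)) \<and>
     (\<forall>(i, j)\<in>r. p i j \<in> hom (G j) (G i)) \<and>
     (\<forall>i\<in>I. \<forall>x\<in>carrier (G i). p i i x = x) \<and>
     (\<forall>i j k. (i, j) \<in> r \<longrightarrow> (j, k) \<in> r \<longrightarrow> (\<forall>x\<in>carrier (G k). p i j (p j k x) = p i k x))"

definition inverse_limit_group ::
  "'i set \<Rightarrow> ('i \<times> 'i) set \<Rightarrow> ('i \<Rightarrow> ('a, 'c) monoid_scheme) \<Rightarrow> ('i \<Rightarrow> 'i \<Rightarrow> 'a \<Rightarrow> 'a) \<Rightarrow>
     ('i \<Rightarrow> 'a) monoid" where
  "inverse_limit_group I r G p =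
     (product_group I G)
       \<lparr>carrier := {x \<in> carrier (product_group I G). \<forall>(i, j)\<in>r. p i j (x j) = x i}\<rparr>"

definition inverse_limit_topology ::
  "'i set \<Rightarrow> ('i \<times> 'i) set \<Rightarrow> ('i \<Rightarrow> ('a, 'c) monoid_scheme) \<Rightarrow> ('i \<Rightarrow> 'i \<Rightarrow> 'a \<Rightarrow> 'a) \<Rightarrow>
     ('i \<Rightarrow> 'a) topology" where
  "inverse_limit_topology I r G p =
     subtopology (product_topology (\<lambda>i. discrete_topology (carrier (G i))) I)
       (carrier (inverse_limit_group I r G p))"

lemma topspace_inverse_limit_topology:
  "topspace (inverse_limit_topology I r G p) = carrier (inverse_limit_group I r G p)"
  by (auto simp: inverse_limit_topology_def inverse_limit_group_def)

end

theory Submission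
  imports Defs
begin

text \<open>
  Let \<open>G\<close> be the group of all homomorphisms \<open>\<int>\<^sup>\<nat> \<rightarrow> \<int>\<close> with the topology of pointwise convergence. It is the
  inverse limit of its images in \<open>\<int>\<^sup>F\<close>, for \<open>F\<close> a finite set of sequences, and these are
  subgroups of \<open>\<int>\<^sup>F\<close>. By Specker's theorem an element of \<open>G\<close> is a finite integer combination of
  coordinates, and the same argument shows that compact subsets of \<open>G\<close> are finite. Hence the dual \<open>D\<close>
  carries the topology of pointwise convergence on the coordinates, doubling on \<open>D\<close> is surjective and
  open, and the kernel of doubling is a continuous image of \<open>{0, 1}\<^sup>\<nat>\<close>, hence compact. So the characters
  of \<open>D\<close> that are small on this kernel form an open set in the bidual; such a character is trivial on the
  kernel, so it factors through doubling, that is, it is the double of a character. Thus the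
  doubles contain a neighbourhood of zero in the bidual. In \<open>G\<close> they do not: otherwise the
  annihilator of some finite \<open>F\<close> would consist of doubles, hence be divisible by 2 and so trivial,
  whereas \<open>G\<close> has infinite rank.
\<close>

section \<open>Homomorphisms from integer sequences to the integers\<close>

text \<open>Since \<open>reflexive_group\<close> admits every isomorphism and not just evaluation,
  the proof needs a property that each topological isomorphism preserves. The one used is whether
  the elements \<open>x + x\<close> contain a neighbourhood of zero; the bidual itself is never
  computed. The two sides differ because \<open>G\<close> has only finite compact sets, while its
  dual has an infinite compact one, the kernel of doubling, which supplies the bidual with more open
  sets. Two obstacles shape the details. A member of \<open>D\<close> must factor through
  restriction to finitely many sequences, so square roots in \<open>D\<close> cannot be assembled
  coordinate by coordinate; they come from halving a real-valued lift, which exists because the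
  groups of restrictions are free. Moreover the halves of finitely many coordinates must be
  adjustable, and the kernel of doubling must be the full image of \<open>{0, 1}\<close> sequences.
  Both hold because the topology of \<open>G\<close> makes evaluation at every integer sequence
  continuous, which is why the index set consists of finite sets of arbitrary sequences.\<close>

definition hom_int :: "((nat \<Rightarrow> int) \<Rightarrow> int) set" where
  "hom_int = {g. \<forall>a b. g (\<lambda>i. a i + b i) = g a + g b}"

definition unit_seq :: "nat \<Rightarrow> nat \<Rightarrow> int" where
  "unit_seq k = (\<lambda>i. if i = k then 1 else 0)"

lemma hom_intD: "g \<in> hom_int \<Longrightarrow> g (\<lambda>i. a i + b i) = g a + g b"
  by (simp add: hom_int_def)

lemma hom_int_zero: "g \<in> hom_int \<Longrightarrow> g (\<lambda>_. 0) = 0"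
  using hom_intD[of g "\<lambda>_. 0" "\<lambda>_. 0"] by simp

lemma hom_int_sum:
  assumes "g \<in> hom_int"
  shows "g (\<lambda>i. \<Sum>k\<in>A. f k i) = (\<Sum>k\<in>A. g (f k))"
  by (induction A rule: infinite_finite_induct) (simp_all add: hom_int_zero[OF assms] hom_intD[OF assms])

lemma hom_int_uminus:
  assumes "g \<in> hom_int"
  shows "g (\<lambda>i. - a i) = - g a"
  using hom_intD[OF assms, of a "\<lambda>i. - a i"] hom_int_zero[OF assms] by simp

lemma hom_int_scale:
  assumes "g \<in> hom_int"
  shows "g (\<lambda>i. c * a i) = c * g a"
proof -
  have nat: "g (\<lambda>i. int n * a i) = int n * g a" for n
    by (induction n) (simp_all add: hom_int_zero[OF assms] hom_intD[OF assms] distrib_right)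
  show ?thesis
    using nat[of "nat c"] nat[of "nat (- c)"] hom_int_uminus[OF assms, of "\<lambda>i. - c * a i"]
    by (cases "c \<ge> 0") simp_all
qed

lemma hom_int_add: "g \<in> hom_int \<Longrightarrow> h \<in> hom_int \<Longrightarrow> (\<lambda>a. g a + h a) \<in> hom_int"
  by (simp add: hom_int_def)

lemma hom_int_minus: "g \<in> hom_int \<Longrightarrow> h \<in> hom_int \<Longrightarrow> (\<lambda>a. g a - h a) \<in> hom_int"
  by (simp add: hom_int_def)

lemma zero_in_hom_int: "(\<lambda>a. 0) \<in> hom_int"
  by (simp add: hom_int_def)

lemma hom_int_cmult: "g \<in> hom_int \<Longrightarrow> (\<lambda>a. c * g a) \<in> hom_int"
  by (simp add: hom_int_def distrib_left)

lemma hom_int_coordinate: "(\<lambda>a. a k) \<in> hom_int"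
  by (simp add: hom_int_def)

lemma hom_int_sums: "(\<And>k. k \<in> A \<Longrightarrow> f k \<in> hom_int) \<Longrightarrow> (\<lambda>a. \<Sum>k\<in>A. f k a) \<in> hom_int"
  by (induction A rule: infinite_finite_induct) (simp_all add: zero_in_hom_int hom_int_add)

text \<open>A tail whose entries are multiples of \<open>c\<close> contributes a multiple of
  \<open>c\<close>. So \<open>g a\<close> is known modulo \<open>c\<close> from finitely many values
  at unit sequences, although nothing is assumed about the behaviour of \<open>g\<close> on infinite
  sums.\<close>

lemma hom_int_split:
  assumes "g \<in> hom_int" and "\<And>i. i \<ge> n \<Longrightarrow> a i = c * b i"
  shows "g a = (\<Sum>k<n. a k * g (unit_seq k)) + c * g (\<lambda>i. if i < n then 0 else b i)"
proof -
  have "a = (\<lambda>i. (\<Sum>k<n. a k * unit_seq k i) + c * (if i < n then 0 else b i))"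
    using assms(2) by (auto simp: unit_seq_def if_distrib cong: if_cong)
  then have "g a = g (\<lambda>i. (\<Sum>k<n. a k * unit_seq k i) + c * (if i < n then 0 else b i))"
    by simp
  also have "\<dots> = (\<Sum>k<n. a k * g (unit_seq k)) + c * g (\<lambda>i. if i < n then 0 else b i)"
    by (simp only: hom_intD[OF assms(1)] hom_int_sum[OF assms(1)] hom_int_scale[OF assms(1)])
  finally show ?thesis .
qed

text \<open>If the coordinates of a homomorphism \<open>g\<close> are bounded by \<open>\<beta>\<close>, then for large \<open>n\<close> the value of \<open>g\<close> at
  such a sequence \<open>c\<close> is determined by its residue modulo \<open>c n\<close>, hence by the first \<open>n\<close> coordinates.\<close>

lemma exists_rapid_divisibility_chain:
  fixes \<beta> :: "nat \<Rightarrow> int"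
  assumes "\<And>k. \<beta> k \<ge> 0"
  obtains c :: "nat \<Rightarrow> int" where "\<And>n i. n \<le> i \<Longrightarrow> c n dvd c i"
    and "\<And>n. c (Suc n) > int n + (\<Sum>k<Suc n. c k * \<beta> k)" and "\<And>n. c n > 0"
proof -
  \<comment> \<open>The state is the current term together with the weighted sum of all earlier
    ones. Each term is multiplied by a factor that exceeds the required lower bound by one, which
    yields divisibility and growth at once.\<close>
  define p :: "nat \<Rightarrow> int \<times> int" where
    "p = rec_nat (1, 0) (\<lambda>n (c, s). (c * (int n + 1 + s + c * \<beta> n), s + c * \<beta> n))"
  define c where "c n = fst (p n)" for n
  have c_0: "c 0 = 1"
    by (simp add: c_def p_def)
  have s: "snd (p n) = (\<Sum>k<n. c k * \<beta> k)" for n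
    by (induction n) (simp_all add: p_def c_def case_prod_unfold)
  have c_Suc: "c (Suc n) = c n * (int n + 1 + (\<Sum>k<Suc n. c k * \<beta> k))" for n
    by (simp add: s[symmetric]) (simp add: p_def c_def case_prod_unfold algebra_simps)
  have pos: "c n > 0" for n
  proof (induction n rule: less_induct)
    case (less n)
    show ?case
    proof (cases n)
      case (Suc m)
      then have "(\<Sum>k<Suc m. c k * \<beta> k) \<ge> 0"
        using less assms by (intro sum_nonneg mult_nonneg_nonneg) (auto intro: less_imp_le)
      then have "int m + 1 + (\<Sum>k<Suc m. c k * \<beta> k) > 0" by linarith
      moreover have "c m > 0" using less Suc by simp
      ultimately show ?thesis unfolding Suc c_Suc by (rule mult_pos_pos[rotated])
    qed (simp add: c_0)
  qed
  show thesis
  proof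
    show "c n dvd c i" if "n \<le> i" for n i
      using that by (induction i rule: dec_induct) (auto simp: c_Suc intro: dvd_mult2)
    show "c (Suc n) > int n + (\<Sum>k<Suc n. c k * \<beta> k)" for n
    proof -
      have "(\<Sum>k<Suc n. c k * \<beta> k) \<ge> 0"
        using pos assms by (intro sum_nonneg mult_nonneg_nonneg) (auto intro: less_imp_le)
      then have "0 \<le> int n + 1 + (\<Sum>k<Suc n. c k * \<beta> k)"
        by linarith
      moreover have "1 \<le> c n"
        using pos[of n] by linarith
      ultimately have "1 * (int n + 1 + (\<Sum>k<Suc n. c k * \<beta> k)) \<le> c (Suc n)"
        unfolding c_Suc by (rule mult_right_mono[rotated])
      then have "int n + 1 + (\<Sum>k<Suc n. c k * \<beta> k) \<le> c (Suc n)"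
        unfolding mult_1 .
      then show ?thesis by linarith
    qed
  qed (rule pos)
qed

text \<open>A single chain \<open>c\<close>, built from bounds valid on all of \<open>K\<close>, and
  a single bound for the values at \<open>c\<close> make the cut-off index common to the whole
  family. A singleton \<open>K\<close> gives the finite support of one homomorphism; larger
  \<open>K\<close> will be compact sets.\<close>

lemma pointwise_bounded_hom_int_support:
  assumes K: "K \<subseteq> hom_int" and bdd: "\<And>a. \<exists>b. \<forall>g\<in>K. \<bar>g a\<bar> \<le> b"
  shows "\<exists>n. \<forall>g\<in>K. \<forall>k\<ge>n. g (unit_seq k) = 0"
proof -
  have "\<forall>k. \<exists>b\<ge>0. \<forall>g\<in>K. \<bar>g (unit_seq k)\<bar> \<le> b"
  proof
    fix k
    obtain b where "\<forall>g\<in>K. \<bar>g (unit_seq k)\<bar> \<le> b"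
      using bdd by blast
    then show "\<exists>b\<ge>0. \<forall>g\<in>K. \<bar>g (unit_seq k)\<bar> \<le> b"
      by (intro exI[of _ "\<bar>b\<bar>"]) fastforce
  qed
  then obtain \<beta> where \<beta>: "\<And>k. \<beta> k \<ge> 0" "\<And>k g. g \<in> K \<Longrightarrow> \<bar>g (unit_seq k)\<bar> \<le> \<beta> k"
    by metis
  obtain c where dvd: "\<And>n i. n \<le> i \<Longrightarrow> c n dvd c i"
    and big: "\<And>n. c (Suc n) > int n + (\<Sum>k<Suc n. c k * \<beta> k)" and pos: "\<And>n. c n > 0"
    using exists_rapid_divisibility_chain[of \<beta>, OF \<beta>(1)] by blast
  obtain b where b: "\<And>g. g \<in> K \<Longrightarrow> \<bar>g c\<bar> \<le> b"
    using bdd by blast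
  \<comment> \<open>The tail of \<open>c\<close> contributes the multiple
    \<open>c (Suc n) * t\<close>. Both \<open>g c\<close> and the partial sum are so small compared
    with \<open>c (Suc n)\<close> that the multiple is smaller than its modulus, hence zero.\<close>
  have partial: "g c = (\<Sum>k<Suc n. c k * g (unit_seq k))" if g: "g \<in> K" and n: "b \<le> int n" for g n
  proof -
    define t where "t = g (\<lambda>i. if i < Suc n then 0 else c i div c (Suc n))"
    have eq: "g c = (\<Sum>k<Suc n. c k * g (unit_seq k)) + c (Suc n) * t"
      unfolding t_def
      by (rule hom_int_split) (use g K dvd in auto)
    have "\<bar>\<Sum>k<Suc n. c k * g (unit_seq k)\<bar> \<le> (\<Sum>k<Suc n. \<bar>c k * g (unit_seq k)\<bar>)"
      by (rule sum_abs)
    also have "\<dots> \<le> (\<Sum>k<Suc n. c k * \<beta> k)"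
      using \<beta>(2)[OF g] by (intro sum_mono) (simp add: abs_mult abs_of_pos[OF pos] pos)
    finally have "\<bar>c (Suc n) * t\<bar> < c (Suc n)"
      using eq b[OF g] big[of n] n by linarith
    then have "t = 0"
      using pos[of "Suc n"] by (simp add: abs_mult)
    then show ?thesis using eq by simp
  qed
  have "g (unit_seq k) = 0" if "g \<in> K" and k: "k \<ge> Suc (nat b)" for g k
  proof -
    obtain m where m: "k = Suc m" "b \<le> int m"
      using k by (cases k) auto
    \<comment> \<open>Two consecutive partial sums both equal \<open>g c\<close>; their difference
      is the term with index \<open>k\<close>.\<close>
    have "c k * g (unit_seq k) = 0"
      using partial[OF \<open>g \<in> K\<close>, of m] partial[OF \<open>g \<in> K\<close>, of "Suc m"] m by simp
    then show ?thesis using pos[of k] by simp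
  qed
  then show ?thesis by blast
qed

section \<open>Specker's theorem\<close>

lemma eq_0_if_powers_dvd:
  fixes p x :: int
  assumes "p \<ge> 2" and "\<And>n. p ^ n dvd x"
  shows "x = 0"
proof (rule ccontr)
  assume "x \<noteq> 0"
  have "\<bar>x\<bar> < 2 ^ nat \<bar>x\<bar>"
    using of_nat_less_two_power[of "nat \<bar>x\<bar>", where 'a = int] by simp
  also have "\<dots> \<le> p ^ nat \<bar>x\<bar>"
    using assms(1) by (intro power_mono) auto
  also have "\<dots> \<le> \<bar>x\<bar>"
    using assms(2) \<open>x \<noteq> 0\<close> by (intro zdvd_imp_le) auto
  finally show False by simp
qed

text \<open>If the \<open>i\<close>-th entry is divisible by \<open>p ^ i\<close>, dropping the
  first \<open>n\<close> terms shows that the value is divisible by \<open>p ^ n\<close>, for every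
  \<open>n\<close>, so it is zero. As \<open>2 ^ i\<close> and \<open>3 ^ i\<close> are coprime,
  every sequence is the sum of one such sequence for \<open>p = 2\<close> and one for
  \<open>p = 3\<close>.\<close>

lemma hom_int_eq_0:
  assumes g: "g \<in> hom_int" and 0: "\<And>k. g (unit_seq k) = 0"
  shows "g a = 0"
proof -
  have powers: "g (\<lambda>i. p ^ i * u i) = 0" if "p \<ge> 2" for p u
  proof (rule eq_0_if_powers_dvd[OF that])
    fix n
    have "g (\<lambda>i. p ^ i * u i) = (\<Sum>k<n. p ^ k * u k * g (unit_seq k)) +
        p ^ n * g (\<lambda>i. if i < n then 0 else p ^ (i - n) * u i)"
      by (rule hom_int_split[OF g]) (simp add: power_add[symmetric])
    then show "p ^ n dvd g (\<lambda>i. p ^ i * u i)"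
      using 0 by simp
  qed
  have "\<exists>u v. a i = 2 ^ i * u + 3 ^ i * v" for i
  proof -
    have "coprime (2 ^ i :: int) (3 ^ i)"
      by simp
    then obtain x y where "x * 2 ^ i + y * 3 ^ i = (1 :: int)"
      by (metis bezout_int coprime_imp_gcd_eq_1)
    then have "a i = 2 ^ i * (x * a i) + 3 ^ i * (y * a i)"
      by (metis distrib_right mult.assoc mult.commute mult_1)
    then show ?thesis by blast
  qed
  then obtain u v where "\<And>i. a i = 2 ^ i * u i + 3 ^ i * v i"
    by metis
  then have "a = (\<lambda>i. 2 ^ i * u i + 3 ^ i * v i)"
    by auto
  then have "g a = g (\<lambda>i. 2 ^ i * u i) + g (\<lambda>i. 3 ^ i * v i)"
    using hom_intD[OF g] by metis
  then show ?thesis by (simp add: powers)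
qed

lemma hom_int_expansion:
  assumes "g \<in> hom_int" and n: "\<And>k. k \<ge> n \<Longrightarrow> g (unit_seq k) = 0"
  shows "g a = (\<Sum>k<n. g (unit_seq k) * a k)"
proof -
  have "(\<Sum>k<n. g (unit_seq k) * unit_seq j k) = g (unit_seq j)" for j
    using n[of j] by (simp add: unit_seq_def if_distrib cong: if_cong)
  moreover have "(\<lambda>a. g a - (\<Sum>k<n. g (unit_seq k) * a k)) \<in> hom_int"
    by (intro hom_int_minus hom_int_sums hom_int_cmult hom_int_coordinate assms(1))
  ultimately have "g a - (\<Sum>k<n. g (unit_seq k) * a k) = 0"
    using hom_int_eq_0[of "\<lambda>a. g a - (\<Sum>k<n. g (unit_seq k) * a k)" a] by simp
  then show ?thesis
    by (rule eq_iff_diff_eq_0[THEN iffD2])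
qed

section \<open>Finite-rank groups of integer-valued functions\<close>

definition additive_subgroup :: "('b \<Rightarrow> int) set \<Rightarrow> bool" where
  "additive_subgroup P \<longleftrightarrow> (\<lambda>_. 0) \<in> P \<and> (\<forall>x\<in>P. \<forall>y\<in>P. (\<lambda>a. x a - y a) \<in> P)"

text \<open>The basis is indexed by itself, so coefficient families are functions on its elements,
  as in \<open>free_Abelian_group B\<close>.\<close>

definition int_basis :: "('b \<Rightarrow> int) set \<Rightarrow> ('b \<Rightarrow> int) set \<Rightarrow> bool" where
  "int_basis B P \<longleftrightarrow> finite B \<and> B \<subseteq> P \<and>
     (\<forall>x\<in>P. \<exists>k. x = (\<lambda>a. \<Sum>b\<in>B. k b * b a)) \<and>
     (\<forall>k. (\<forall>a. (\<Sum>b\<in>B. k b * b a) = 0) \<longrightarrow> (\<forall>b\<in>B. k b = 0))"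

definition pointwise_group :: "('b \<Rightarrow> int) set \<Rightarrow> ('b \<Rightarrow> int) monoid" where
  "pointwise_group P = \<lparr>carrier = P, monoid.mult = (\<lambda>x y a. x a + y a), one = (\<lambda>_. 0)\<rparr>"

lemma pointwise_group_simps [simp]:
  "carrier (pointwise_group P) = P"
  "x \<otimes>\<^bsub>pointwise_group P\<^esub> y = (\<lambda>a. x a + y a)"
  "\<one>\<^bsub>pointwise_group P\<^esub> = (\<lambda>_. 0)"
  by (simp_all add: pointwise_group_def)

lemma additive_subgroup_diff:
  "additive_subgroup P \<Longrightarrow> x \<in> P \<Longrightarrow> y \<in> P \<Longrightarrow> (\<lambda>a. x a - y a) \<in> P"
  by (simp add: additive_subgroup_def)

lemma additive_subgroup_zero: "additive_subgroup P \<Longrightarrow> (\<lambda>_. 0) \<in> P"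
  by (simp add: additive_subgroup_def)

lemma additive_subgroup_uminus:
  assumes "additive_subgroup P" "x \<in> P" shows "(\<lambda>a. - x a) \<in> P"
  using additive_subgroup_diff[OF assms(1) additive_subgroup_zero[OF assms(1)] assms(2)] by simp

lemma additive_subgroup_add:
  assumes "additive_subgroup P" "x \<in> P" "y \<in> P" shows "(\<lambda>a. x a + y a) \<in> P"
  using additive_subgroup_diff[OF assms(1,2) additive_subgroup_uminus[OF assms(1,3)]] by simp

lemma additive_subgroup_scale:
  assumes "additive_subgroup P" "x \<in> P" shows "(\<lambda>a. c * x a) \<in> P"
proof -
  have nat: "(\<lambda>a. int n * x a) \<in> P" for n
    by (induction n)
      (simp_all add: distrib_right additive_subgroup_zero[OF assms(1)]
        additive_subgroup_add[OF assms])
  show ?thesis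
    using nat[of "nat c"] additive_subgroup_uminus[OF assms(1) nat[of "nat (- c)"]]
    by (cases "c \<ge> 0") simp_all
qed

lemma additive_subgroup_combination:
  assumes "additive_subgroup P" "B \<subseteq> P"
  shows "(\<lambda>a. \<Sum>b\<in>B. k b * b a) \<in> P"
  using assms(2)
  by (induction B rule: infinite_finite_induct)
    (simp_all add: additive_subgroup_zero additive_subgroup_add additive_subgroup_scale assms(1))

lemma comm_group_pointwise_group:
  assumes "additive_subgroup P"
  shows "comm_group (pointwise_group P)"
proof (rule comm_groupI)
  show "\<exists>y\<in>carrier (pointwise_group P). y \<otimes>\<^bsub>pointwise_group P\<^esub> x = \<one>\<^bsub>pointwise_group P\<^esub>"
    if "x \<in> carrier (pointwise_group P)" for x
    using that additive_subgroup_uminus[OF assms] by (intro bexI[of _ "\<lambda>a. - x a"]) auto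
qed (auto simp: additive_subgroup_add[OF assms] additive_subgroup_zero[OF assms] ac_simps)

text \<open>The values at \<open>a\<close> form a nonzero subgroup of the integers. A member with
  least positive value there generates it: division with remainder would otherwise produce a smaller
  positive value.\<close>

lemma additive_subgroup_generator:
  fixes v :: "'b \<Rightarrow> int"
  assumes P: "additive_subgroup P" and h: "h \<in> P" "h a \<noteq> 0"
  obtains g where "g \<in> P" "g a \<noteq> 0" "\<And>x. x \<in> P \<Longrightarrow> g a dvd x a"
proof -
  have "\<exists>m g. g \<in> P \<and> g a = int m \<and> m > 0"
    using h additive_subgroup_uminus[OF P h(1)]
    by (cases "h a > 0") (metis zero_less_imp_eq_int, metis zero_less_imp_eq_int linorder_neqE_linordered_idom neg_0_less_iff_less)
  then obtain m where m: "\<exists>g\<in>P. g a = int m \<and> m > 0"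
    and least: "\<And>n. n < m \<Longrightarrow> \<not> (\<exists>g\<in>P. g a = int n \<and> n > 0)"
    using exists_least_iff[of "\<lambda>m. \<exists>g\<in>P. g a = int m \<and> m > 0"] by blast
  then obtain g where g: "g \<in> P" "g a = int m" "m > 0"
    by blast
  have "g a dvd x a" if "x \<in> P" for x
  proof -
    have "(\<lambda>b. x b - x a div int m * g b) \<in> P"
      using P that g(1) by (intro additive_subgroup_diff additive_subgroup_scale)
    moreover have "x a - x a div int m * g a = int (nat (x a mod int m))"
      using g by (simp add: minus_div_mult_eq_mod)
    moreover have "nat (x a mod int m) < m"
      using g(3) by (simp add: nat_less_iff)
    ultimately have "\<not> nat (x a mod int m) > 0"
      using least[of "nat (x a mod int m)"] by (metis (no_types, lifting))
    then have "x a mod int m = 0"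
      using g(3) pos_mod_sign[of "int m" "x a"] by linarith
    then show ?thesis
      using g(2) by auto
  qed
  with g show thesis
    by (intro that[of g]) auto
qed

text \<open>Evaluation at \<open>a\<close> maps \<open>P\<close> onto the multiples of
  \<open>g a\<close>, so \<open>P\<close> is the direct sum of its kernel and the multiples of
  \<open>g\<close>. For independence, look at \<open>a\<close> first: there only \<open>g\<close>
  contributes, so its coefficient vanishes.\<close>

lemma int_basis_insert:
  assumes P: "additive_subgroup P" and B: "int_basis B {x\<in>P. x a = 0}"
    and g: "g \<in> P" "g a \<noteq> 0" "\<And>x. x \<in> P \<Longrightarrow> g a dvd x a"
  shows "int_basis (insert g B) P"
proof -
  have fin: "finite B" and sub: "B \<subseteq> {x\<in>P. x a = 0}"
    and span: "\<And>x. x \<in> P \<Longrightarrow> x a = 0 \<Longrightarrow> \<exists>k. x = (\<lambda>a. \<Sum>b\<in>B. k b * b a)"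
    and indep: "\<And>k. (\<And>a. (\<Sum>b\<in>B. k b * b a) = 0) \<Longrightarrow> (\<forall>b\<in>B. k b = 0)"
    using B unfolding int_basis_def by auto
  have notin: "g \<notin> B"
    using sub g(2) by auto
  have "\<exists>k. x = (\<lambda>c. \<Sum>b\<in>insert g B. k b * b c)" if x: "x \<in> P" for x
  proof -
    obtain q where q: "x a = g a * q"
      using g(3)[OF x] by (auto elim: dvdE)
    have "(\<lambda>c. x c - q * g c) \<in> P"
      using P x g(1) by (intro additive_subgroup_diff additive_subgroup_scale)
    then obtain k where k: "(\<lambda>c. x c - q * g c) = (\<lambda>c. \<Sum>b\<in>B. k b * b c)"
      using span[of "\<lambda>c. x c - q * g c"] q by auto
    have "x c = (\<Sum>b\<in>insert g B. (k(g := q)) b * b c)" for c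
    proof -
      have "(\<Sum>b\<in>B. (k(g := q)) b * b c) = (\<Sum>b\<in>B. k b * b c)"
        using notin by (intro sum.cong) auto
      then show ?thesis
        using fun_cong[OF k, of c] fin notin by simp
    qed
    then show ?thesis by blast
  qed
  moreover have "\<forall>b\<in>insert g B. k b = 0" if k: "\<And>c. (\<Sum>b\<in>insert g B. k b * b c) = 0" for k
  proof -
    have "(\<Sum>b\<in>B. k b * b a) = 0"
      using sub by (intro sum.neutral) auto
    then have "k g = 0"
      using k[of a] fin notin g(2) by simp
    then show ?thesis
      using k fin notin indep[of k] by simp
  qed
  ultimately show ?thesis
    using fin sub g(1) unfolding int_basis_def by auto
qed

text \<open>This is freeness of subgroups of a free group of finite rank, by induction on the number
  of coordinates: passing to the kernel of one evaluation removes a coordinate and costs at most one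
  basis element.\<close>

lemma exists_int_basis:
  assumes "finite F" and "additive_subgroup P" and "\<And>x a. x \<in> P \<Longrightarrow> a \<notin> F \<Longrightarrow> x a = 0"
  shows "\<exists>B. int_basis B P"
  using assms
proof (induction F arbitrary: P rule: finite_induct)
  case empty
  then have "P = {\<lambda>_. 0}"
    by (auto simp: additive_subgroup_def)
  then show ?case
    by (intro exI[of _ "{}"]) (auto simp: int_basis_def)
next
  case (insert a F)
  let ?P0 = "{x\<in>P. x a = 0}"
  have "additive_subgroup ?P0"
    using insert.prems(1) by (auto simp: additive_subgroup_def)
  moreover have "x b = 0" if "x \<in> ?P0" "b \<notin> F" for x b
    using that insert.prems(2)[of x b] by auto
  ultimately obtain B where B: "int_basis B ?P0"
    using insert.IH[of ?P0] by blast
  show ?case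
  proof (cases "\<forall>x\<in>P. x a = 0")
    case True
    then have "?P0 = P" by auto
    then show ?thesis using B by auto
  next
    case False
    then obtain h where "h \<in> P" "h a \<noteq> 0" by blast
    then obtain g where "g \<in> P" "g a \<noteq> 0" "\<And>x. x \<in> P \<Longrightarrow> g a dvd x a"
      using additive_subgroup_generator[OF insert.prems(1)] by metis
    then show ?thesis
      using int_basis_insert[OF insert.prems(1) B] by blast
  qed
qed

lemma int_basis_independent:
  assumes "int_basis B P" and "\<And>a. (\<Sum>b\<in>B. k b * b a) = 0" and "b \<in> B"
  shows "k b = 0"
  using assms unfolding int_basis_def by blast

lemma int_basis_unique:
  assumes "int_basis B P" and "\<And>a. (\<Sum>b\<in>B. k b * b a) = (\<Sum>b\<in>B. l b * b a)" and "b \<in> B"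
  shows "k b = l b"
proof -
  have "(\<Sum>b\<in>B. (k b - l b) * b a) = 0" for a
    using assms(2) by (simp add: left_diff_distrib sum_subtractf)
  then show ?thesis
    using int_basis_independent[OF assms(1), of "\<lambda>b. k b - l b" b] assms(3) by auto
qed

lemma free_abelian_pointwise_group:
  assumes P: "additive_subgroup P" and B: "int_basis B P"
  shows "free_abelian (pointwise_group P)"
proof -
  have fin: "finite B" and sub: "B \<subseteq> P"
    and span: "\<And>x. x \<in> P \<Longrightarrow> \<exists>k. x = (\<lambda>a. \<Sum>b\<in>B. k b * b a)"
    using B unfolding int_basis_def by auto
  let ?F = "free_Abelian_group B"
  define f where "f c = (\<lambda>a. \<Sum>b\<in>B. poly_mapping.lookup c b * b a)" for c
  have f_carrier: "f c \<in> P" for c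
    unfolding f_def by (rule additive_subgroup_combination[OF P sub])
  have "f \<in> hom ?F (pointwise_group P)"
    using f_carrier by (auto simp: hom_def f_def lookup_add distrib_right sum.distrib)
  moreover have "inj_on f (carrier ?F)"
  proof (rule inj_onI)
    fix c d assume cd: "c \<in> carrier ?F" "d \<in> carrier ?F" "f c = f d"
    have "poly_mapping.lookup c b = poly_mapping.lookup d b" for b
    proof (cases "b \<in> B")
      case True
      then show ?thesis
        using int_basis_unique[OF B, of "poly_mapping.lookup c" "poly_mapping.lookup d"]
          fun_cong[OF cd(3)] unfolding f_def by blast
    next
      case False
      then have "b \<notin> Poly_Mapping.keys c" "b \<notin> Poly_Mapping.keys d"
        using cd by auto
      then show ?thesis
        by (simp add: in_keys_iff)
    qed
    then show "c = d"
      by (intro poly_mapping_eqI)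
  qed
  moreover have "P \<subseteq> f ` carrier ?F"
  proof
    fix x assume "x \<in> P"
    then obtain k where k: "x = (\<lambda>a. \<Sum>b\<in>B. k b * b a)"
      using span by blast
    \<comment> \<open>The family \<open>k\<close> is unconstrained outside \<open>B\<close>, so it
      is reset to zero there to obtain finite support with keys in \<open>B\<close>.\<close>
    define c where "c = Abs_poly_mapping (\<lambda>b. if b \<in> B then k b else 0)"
    have c: "poly_mapping.lookup c = (\<lambda>b. if b \<in> B then k b else 0)"
      unfolding c_def by (rule lookup_Abs_poly_mapping) (auto intro: finite_subset[OF _ fin])
    have "Poly_Mapping.keys c \<subseteq> B"
      by (auto simp: in_keys_iff c split: if_splits)
    moreover have "f c = x"
      unfolding f_def k c by (intro ext sum.cong) auto
    ultimately show "x \<in> f ` carrier ?F"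
      by (intro image_eqI[of _ _ c]) auto
  qed
  ultimately have "f \<in> iso ?F (pointwise_group P)"
    using f_carrier by (auto simp: iso_def bij_betw_def)
  then have "?F \<cong> pointwise_group P"
    by (auto simp: is_iso_def)
  then have "pointwise_group P \<cong> ?F"
    by (rule group.iso_sym[OF group_free_Abelian_group])
  then show ?thesis
    unfolding free_abelian_def using comm_group_pointwise_group[OF P] by blast
qed

lemma finitely_generated_pointwise_group:
  assumes P: "additive_subgroup P" and B: "int_basis B P"
  shows "finitely_generated_group (pointwise_group P)"
proof -
  let ?G = "pointwise_group P"
  interpret comm_group ?G
    by (rule comm_group_pointwise_group[OF P])
  have fin: "finite B" and sub: "B \<subseteq> P"
    and span: "\<And>x. x \<in> P \<Longrightarrow> \<exists>k. x = (\<lambda>a. \<Sum>b\<in>B. k b * b a)"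
    using B unfolding int_basis_def by auto
  have gen: "subgroup (generate ?G B) ?G"
    using sub by (intro generate_is_subgroup) simp
  have inv: "inv\<^bsub>?G\<^esub> x = (\<lambda>a. - x a)" if "x \<in> P" for x
    using that by (intro inv_equality) (simp_all add: additive_subgroup_uminus[OF P])
  have "additive_subgroup (generate ?G B)"
    unfolding additive_subgroup_def
  proof (intro conjI ballI)
    show "(\<lambda>_. 0) \<in> generate ?G B"
      using subgroup.one_closed[OF gen] by simp
    fix x y assume xy: "x \<in> generate ?G B" "y \<in> generate ?G B"
    then have "y \<in> P"
      using subgroup.subset[OF gen] by auto
    then show "(\<lambda>a. x a - y a) \<in> generate ?G B"
      using subgroup.m_closed[OF gen xy(1) subgroup.m_inv_closed[OF gen xy(2)]] by (simp add: inv)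
  qed
  moreover have "B \<subseteq> generate ?G B"
    by (auto intro: generate.incl)
  ultimately have "(\<lambda>a. \<Sum>b\<in>B. k b * b a) \<in> generate ?G B" for k
    by (rule additive_subgroup_combination)
  then have "P \<subseteq> generate ?G B"
    using span by fastforce
  then have "generate ?G B = P"
    using subgroup.subset[OF gen] by auto
  then show ?thesis
    unfolding finitely_generated_group_def using fin sub by auto
qed

section \<open>The circle group and dual maps\<close>

lemma circle_proj_altdef: "circle_proj x = (\<lambda>n. n + x) ` \<int>"
  by (auto simp: circle_proj_def r_coset_def real_add_group_def)

lemma circle_proj_eq_iff: "circle_proj x = circle_proj y \<longleftrightarrow> x - y \<in> \<int>"
proof
  assume "circle_proj x = circle_proj y"
  moreover have "x \<in> circle_proj x"
    unfolding circle_proj_altdef by (intro image_eqI[of _ _ 0]) auto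
  ultimately show "x - y \<in> \<int>"
    by (auto simp: circle_proj_altdef)
next
  assume xy: "x - y \<in> \<int>"
  have "n + x \<in> circle_proj y" "n + y \<in> circle_proj x" if "n \<in> \<int>" for n
    unfolding circle_proj_altdef using xy that
    by (auto intro: image_eqI[of _ _ "n + (x - y)"] image_eqI[of _ _ "n - (x - y)"])
  then show "circle_proj x = circle_proj y"
    by (auto simp: circle_proj_altdef)
qed

lemma circle_mult: "circle_proj x \<otimes>\<^bsub>circle_group\<^esub> circle_proj y = circle_proj (x + y)"
proof -
  have "circle_proj x \<otimes>\<^bsub>circle_group\<^esub> circle_proj y = (\<Union>m\<in>\<int>. \<Union>n\<in>\<int>. {m + x + (n + y)})"
    by (auto simp: circle_group_def FactGroup_def set_mult_def circle_proj_altdef real_add_group_def)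
  also have "\<dots> = circle_proj (x + y)"
  proof -
    have "m + x + (n + y) \<in> circle_proj (x + y)" if "m \<in> \<int>" "n \<in> \<int>" for m n
      unfolding circle_proj_altdef using that by (intro image_eqI[of _ _ "m + n"]) auto
    moreover have "m + (x + y) \<in> (\<Union>m\<in>\<int>. \<Union>n\<in>\<int>. {m + x + (n + y)})" if "m \<in> \<int>" for m
      using that by (intro UN_I[of m] UN_I[of 0]) auto
    ultimately show ?thesis
      by (auto simp: circle_proj_altdef)
  qed
  finally show ?thesis .
qed

lemma circle_one: "\<one>\<^bsub>circle_group\<^esub> = circle_proj 0"
  by (simp add: circle_group_def FactGroup_def circle_proj_altdef)

lemma circle_projE:
  assumes "z \<in> carrier circle_group" obtains x where "z = circle_proj x"
  using assms by (auto simp: carrier_circle_group)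

lemma circle_proj_in_carrier [simp]: "circle_proj x \<in> carrier circle_group"
  by (simp add: carrier_circle_group)

lemma comm_group_circle_group: "comm_group circle_group"
proof (rule comm_groupI)
  fix x assume "x \<in> carrier circle_group"
  then obtain a where "x = circle_proj a" by (rule circle_projE)
  then show "\<exists>y\<in>carrier circle_group. y \<otimes>\<^bsub>circle_group\<^esub> x = \<one>\<^bsub>circle_group\<^esub>"
    by (intro bexI[of _ "circle_proj (- a)"]) (simp_all add: circle_mult circle_one)
qed (auto elim!: circle_projE simp: circle_mult circle_one ac_simps)

text \<open>The preimage of the image is the union of the integer translates of
  \<open>V\<close>.\<close>

lemma openin_circle_proj_image:
  assumes "open V" shows "openin circle_topology (circle_proj ` V)"
proof -
  have "circle_proj -` circle_proj ` V = (\<Union>n\<in>\<int>. (\<lambda>x. n + x) ` V)"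
  proof (intro equalityI subsetI)
    fix x assume "x \<in> circle_proj -` circle_proj ` V"
    then obtain v where "v \<in> V" "x - v \<in> \<int>"
      by (auto simp: circle_proj_eq_iff)
    then show "x \<in> (\<Union>n\<in>\<int>. (\<lambda>x. n + x) ` V)"
      by (intro UN_I[of "x - v"] image_eqI[of _ _ v]) auto
  next
    fix x assume "x \<in> (\<Union>n\<in>\<int>. (\<lambda>x. n + x) ` V)"
    then obtain n v where "n \<in> \<int>" "v \<in> V" "x = n + v"
      by auto
    then have "circle_proj x = circle_proj v"
      by (simp add: circle_proj_eq_iff)
    then show "x \<in> circle_proj -` circle_proj ` V"
      using \<open>v \<in> V\<close> by (metis imageI vimageI2)
  qed
  then show ?thesis
    using assms by (auto simp: openin_circle_topology intro: open_translation)
qed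

lemma openin_circle_ball:
  assumes "openin circle_topology U" "circle_proj x \<in> U"
  obtains \<epsilon> where "\<epsilon> > 0" "\<And>y. \<bar>y - x\<bar> < \<epsilon> \<Longrightarrow> circle_proj y \<in> U"
proof -
  have "open (circle_proj -` U)"
    using assms(1) by (simp add: openin_circle_topology)
  then obtain \<epsilon> where "\<epsilon> > 0" "ball x \<epsilon> \<subseteq> circle_proj -` U"
    using assms(2) openE by (metis vimageI)
  then show thesis
    by (intro that[of \<epsilon>]) (auto simp: subset_eq dist_real_def abs_minus_commute)
qed

definition circle_arc :: "real \<Rightarrow> real \<Rightarrow> real set set" where
  "circle_arc x \<epsilon> = circle_proj ` {x - \<epsilon><..<x + \<epsilon>}"

lemma openin_circle_arc: "openin circle_topology (circle_arc x \<epsilon>)"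
  unfolding circle_arc_def by (rule openin_circle_proj_image) simp

lemma circle_arcE:
  assumes "z \<in> circle_arc x \<epsilon>" obtains y where "z = circle_proj y" "\<bar>y - x\<bar> < \<epsilon>"
  using assms unfolding circle_arc_def by (auto simp: abs_less_iff)

lemma circle_proj_in_arc: "\<bar>y - x\<bar> < \<epsilon> \<Longrightarrow> circle_proj y \<in> circle_arc x \<epsilon>"
  unfolding circle_arc_def by (intro imageI) auto

text \<open>Let \<open>y\<close> be a representative of modulus below 1/4. If also
  \<open>n * y\<close> is below 1/4, then \<open>(n + 1) * y\<close> is below 1/2 and differs by an
  integer from a number below 1/4; that integer is below 1, hence zero. So all multiples of
  \<open>y\<close> stay below 1/4, and the Archimedean property gives \<open>y = 0\<close>.\<close>

lemma circle_no_small_subgroups: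
  assumes "\<And>n. circle_proj (real n * x) \<in> circle_arc 0 (1/4)"
  shows "circle_proj x = \<one>\<^bsub>circle_group\<^esub>"
proof -
  obtain y where y: "circle_proj x = circle_proj y" "\<bar>y\<bar> < 1/4"
    using assms[of 1] by (auto elim: circle_arcE)
  have "\<bar>real n * y\<bar> < 1/4" for n
  proof (induction n)
    case (Suc n)
    have "real (Suc n) * x - real (Suc n) * y = real (Suc n) * (x - y)"
      by (simp add: right_diff_distrib)
    also have "\<dots> \<in> \<int>"
      using y(1) by (intro Ints_mult) (auto simp: circle_proj_eq_iff)
    finally have "circle_proj (real (Suc n) * x) = circle_proj (real (Suc n) * y)"
      by (simp only: circle_proj_eq_iff)
    then obtain z where z: "circle_proj (real (Suc n) * y) = circle_proj z" "\<bar>z\<bar> < 1/4"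
      using assms[of "Suc n"] by (metis circle_arcE diff_zero)
    then obtain m where m: "real (Suc n) * y - z = of_int m"
      by (auto simp: circle_proj_eq_iff elim: Ints_cases)
    have "real (Suc n) * y = real n * y + y"
      by (simp add: distrib_right)
    then have "\<bar>of_int m :: real\<bar> < 1"
      using Suc y(2) z(2) m by linarith
    then have "m = 0"
      by linarith
    then show ?case
      using m z(2) by simp
  qed simp
  then have "y = 0"
    by (metis abs_mult abs_of_nat less_irrefl mult_zero_right not_le ex_less_of_nat_mult
        zero_less_abs_iff order.strict_trans)
  then show ?thesis
    using y(1) by (simp add: circle_one)
qed

lemma continuous_map_circle_mult:
  assumes "continuous_map S circle_topology f" "continuous_map S circle_topology g"
  shows "continuous_map S circle_topology (\<lambda>x. f x \<otimes>\<^bsub>circle_group\<^esub> g x)"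
  unfolding continuous_map_def
proof (intro conjI allI impI)
  interpret comm_group circle_group
    by (rule comm_group_circle_group)
  have fg: "f x \<in> carrier circle_group" "g x \<in> carrier circle_group" if "x \<in> topspace S" for x
    using assms that by (auto simp: continuous_map_def topspace_circle_topology Pi_iff)
  then show "(\<lambda>x. f x \<otimes>\<^bsub>circle_group\<^esub> g x) \<in> topspace S \<rightarrow> topspace circle_topology"
    by (auto simp: topspace_circle_topology)
  fix U assume U: "openin circle_topology U"
  show "openin S {x \<in> topspace S. f x \<otimes>\<^bsub>circle_group\<^esub> g x \<in> U}"
  proof (subst openin_subopen, intro ballI)
    fix x assume x: "x \<in> {x \<in> topspace S. f x \<otimes>\<^bsub>circle_group\<^esub> g x \<in> U}"
    obtain a b where ab: "f x = circle_proj a" "g x = circle_proj b"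
      using fg x by (metis (no_types, lifting) circle_projE mem_Collect_eq)
    obtain \<epsilon> where e: "\<epsilon> > 0" "\<And>y. \<bar>y - (a + b)\<bar> < \<epsilon> \<Longrightarrow> circle_proj y \<in> U"
      using U x by (auto simp: ab circle_mult elim: openin_circle_ball)
    let ?N = "{y \<in> topspace S. f y \<in> circle_arc a (\<epsilon>/2)} \<inter> {y \<in> topspace S. g y \<in> circle_arc b (\<epsilon>/2)}"
    have "openin S ?N"
      by (intro openin_Int openin_continuous_map_preimage[OF assms(1) openin_circle_arc]
          openin_continuous_map_preimage[OF assms(2) openin_circle_arc])
    moreover have "x \<in> ?N"
      using x e(1) by (auto simp: ab intro: circle_proj_in_arc)
    moreover have "f y \<otimes>\<^bsub>circle_group\<^esub> g y \<in> U" if "y \<in> ?N" for y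
    proof -
      have "f y \<in> circle_arc a (\<epsilon>/2)" "g y \<in> circle_arc b (\<epsilon>/2)"
        using that by auto
      then obtain a' b' where a': "f y = circle_proj a'" "\<bar>a' - a\<bar> < \<epsilon>/2"
        and b': "g y = circle_proj b'" "\<bar>b' - b\<bar> < \<epsilon>/2"
        by (elim circle_arcE) blast
      have "\<bar>a' + b' - (a + b)\<bar> < \<epsilon>"
        using a'(2) b'(2) by linarith
      then show ?thesis
        using e(2) by (simp add: a'(1) b'(1) circle_mult)
    qed
    ultimately show "\<exists>N. openin S N \<and> x \<in> N \<and> N \<subseteq> {x \<in> topspace S. f x \<otimes>\<^bsub>circle_group\<^esub> g x \<in> U}"
      by (intro exI[of _ ?N]) auto
  qed
qed

section \<open>Dual groups and the subbase of the compact-open topology\<close>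

lemma carrier_dual_group_iff:
  "\<phi> \<in> carrier (dual_group H T) \<longleftrightarrow>
     \<phi> \<in> hom H circle_group \<and> \<phi> \<in> extensional (carrier H) \<and> continuous_map T circle_topology \<phi>"
  by (auto simp: dual_group_def)

lemma dual_group_mult:
  "\<phi> \<otimes>\<^bsub>dual_group H T\<^esub> \<psi> = (\<lambda>x\<in>carrier H. \<phi> x \<otimes>\<^bsub>circle_group\<^esub> \<psi> x)"
  by (simp add: dual_group_def)

lemma dual_group_closed:
  assumes closed: "\<And>x y. x \<in> carrier H \<Longrightarrow> y \<in> carrier H \<Longrightarrow> x \<otimes>\<^bsub>H\<^esub> y \<in> carrier H"
    and top: "topspace T = carrier H"
    and "\<phi> \<in> carrier (dual_group H T)" "\<psi> \<in> carrier (dual_group H T)"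
  shows "\<phi> \<otimes>\<^bsub>dual_group H T\<^esub> \<psi> \<in> carrier (dual_group H T)"
proof -
  interpret comm_group circle_group
    by (rule comm_group_circle_group)
  have hom: "\<phi> \<in> hom H circle_group" "\<psi> \<in> hom H circle_group"
    and cont: "continuous_map T circle_topology \<phi>" "continuous_map T circle_topology \<psi>"
    using assms(3,4) by (auto simp: carrier_dual_group_iff)
  have "(\<lambda>x\<in>carrier H. \<phi> x \<otimes>\<^bsub>circle_group\<^esub> \<psi> x) \<in> hom H circle_group"
    using hom closed by (auto simp: hom_def Pi_iff m_ac)
  moreover have "continuous_map T circle_topology (\<lambda>x\<in>carrier H. \<phi> x \<otimes>\<^bsub>circle_group\<^esub> \<psi> x)"
    by (rule continuous_map_eq[OF continuous_map_circle_mult[OF cont]]) (simp add: top)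
  ultimately show ?thesis
    by (simp add: carrier_dual_group_iff dual_group_mult)
qed

lemma openin_dual_topology_subbase:
  assumes "compactin T K" "openin circle_topology U"
  shows "openin (dual_topology H T) {\<phi> \<in> carrier (dual_group H T). \<phi> ` K \<subseteq> U}"
  unfolding dual_topology_def using assms by (intro topology_generated_by_Basis) blast

lemma continuous_map_dual_topologyI:
  assumes "f \<in> topspace S \<rightarrow> carrier (dual_group H T)"
    and "\<And>K U. compactin T K \<Longrightarrow> openin circle_topology U \<Longrightarrow> openin S {x \<in> topspace S. f x ` K \<subseteq> U}"
  shows "continuous_map S (dual_topology H T) f"
  unfolding dual_topology_def
proof (rule continuous_on_generated_topo)
  let ?B = "{{\<phi> \<in> carrier (dual_group H T). \<phi> ` K \<subseteq> U} | K U. compactin T K \<and> openin circle_topology U}"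
  show "openin S (f -` B \<inter> topspace S)" if B: "B \<in> ?B" for B
  proof -
    obtain K U where KU: "compactin T K" "openin circle_topology U"
      and "B = {\<phi> \<in> carrier (dual_group H T). \<phi> ` K \<subseteq> U}"
      using B by blast
    then have "f -` B \<inter> topspace S = {x \<in> topspace S. f x ` K \<subseteq> U}"
      using assms(1) by auto
    then show ?thesis
      using assms(2)[OF KU] by simp
  qed
  have "\<Union>?B = carrier (dual_group H T)"
    using topspace_dual_topology[of H T] unfolding dual_topology_def
    by (simp only: topology_generated_by_topspace)
  then show "f ` topspace S \<subseteq> \<Union>?B"
    using assms(1) by (simp add: image_subset_iff_funcset)
qed

section \<open>Functoriality of the dual and invariance of reflexivity\<close>

definition dual_map :: "('a, 'c) monoid_scheme \<Rightarrow> ('a \<Rightarrow> 'b) \<Rightarrow> ('b \<Rightarrow> real set) \<Rightarrow> ('a \<Rightarrow> real set)" where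
  "dual_map G f \<phi> = (\<lambda>x\<in>carrier G. \<phi> (f x))"

lemma dual_map_hom_continuous:
  assumes closed: "\<And>x y. x \<in> carrier G \<Longrightarrow> y \<in> carrier G \<Longrightarrow> x \<otimes>\<^bsub>G\<^esub> y \<in> carrier G"
    and top: "topspace S = carrier G"
    and f: "f \<in> hom G H" "continuous_map S T f"
  shows "dual_map G f \<in> hom (dual_group H T) (dual_group G S)"
    and "continuous_map (dual_topology H T) (dual_topology G S) (dual_map G f)"
proof -
  have f_carrier: "f x \<in> carrier H" if "x \<in> carrier G" for x
    using f(1) that by (auto simp: hom_def)
  have carrier: "dual_map G f \<phi> \<in> carrier (dual_group G S)" if \<phi>: "\<phi> \<in> carrier (dual_group H T)" for \<phi>
  proof -
    have "dual_map G f \<phi> \<in> hom G circle_group"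
      using \<phi> f(1) closed by (auto simp: dual_map_def carrier_dual_group_iff hom_def Pi_iff)
    moreover have "continuous_map S circle_topology (\<phi> \<circ> f)"
      using \<phi> f(2) by (auto simp: carrier_dual_group_iff intro: continuous_map_compose)
    then have "continuous_map S circle_topology (dual_map G f \<phi>)"
      by (rule continuous_map_eq) (simp add: top dual_map_def)
    ultimately show ?thesis
      by (simp add: carrier_dual_group_iff dual_map_def)
  qed
  show "dual_map G f \<in> hom (dual_group H T) (dual_group G S)"
  proof (rule homI)
    fix \<phi> \<psi>
    show "dual_map G f (\<phi> \<otimes>\<^bsub>dual_group H T\<^esub> \<psi>) = dual_map G f \<phi> \<otimes>\<^bsub>dual_group G S\<^esub> dual_map G f \<psi>"
      by (intro ext) (simp add: dual_map_def dual_group_mult restrict_def f_carrier)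
  qed (rule carrier)
  show "continuous_map (dual_topology H T) (dual_topology G S) (dual_map G f)"
  proof (rule continuous_map_dual_topologyI)
    show "dual_map G f \<in> topspace (dual_topology H T) \<rightarrow> carrier (dual_group G S)"
      using carrier by (simp add: topspace_dual_topology)
    fix K U assume KU: "compactin S K" "openin circle_topology U"
    then have "K \<subseteq> carrier G"
      using top compactin_subset_topspace by blast
    then have "dual_map G f \<phi> ` K = \<phi> ` f ` K" for \<phi>
      by (force simp: dual_map_def)
    moreover have "compactin T (f ` K)"
      using KU(1) f(2) by (rule image_compactin)
    ultimately show "openin (dual_topology H T) {\<phi> \<in> topspace (dual_topology H T). dual_map G f \<phi> ` K \<subseteq> U}"
      using openin_dual_topology_subbase[of T "f ` K" U H] KU(2) by (simp add: topspace_dual_topology)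
  qed
qed

text \<open>The inverse is recorded along with the map because dualising reverses arrows: the dual
  of the inverse is what inverts the dual map.\<close>

definition topological_group_isomorphisms where
  "topological_group_isomorphisms G S H T f g \<longleftrightarrow>
     f \<in> hom G H \<and> g \<in> hom H G \<and> homeomorphic_maps S T f g"

lemma topological_group_isomorphisms_dual:
  assumes fg: "topological_group_isomorphisms G S H T f g"
    and closed: "\<And>x y. x \<in> carrier G \<Longrightarrow> y \<in> carrier G \<Longrightarrow> x \<otimes>\<^bsub>G\<^esub> y \<in> carrier G"
      "\<And>x y. x \<in> carrier H \<Longrightarrow> y \<in> carrier H \<Longrightarrow> x \<otimes>\<^bsub>H\<^esub> y \<in> carrier H"
    and top: "topspace S = carrier G" "topspace T = carrier H"
  shows "topological_group_isomorphisms (dual_group H T) (dual_topology H T)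
    (dual_group G S) (dual_topology G S) (dual_map G f) (dual_map H g)"
proof -
  have f: "f \<in> hom G H" "continuous_map S T f" and g: "g \<in> hom H G" "continuous_map T S g"
    and inv: "\<And>x. x \<in> carrier G \<Longrightarrow> g (f x) = x" "\<And>y. y \<in> carrier H \<Longrightarrow> f (g y) = y"
    using fg by (auto simp: topological_group_isomorphisms_def homeomorphic_maps_def top)
  have carrier: "f x \<in> carrier H" "g y \<in> carrier G" if "x \<in> carrier G" "y \<in> carrier H" for x y
    using f(1) g(1) that by (auto simp: hom_def)
  have "dual_map H g (dual_map G f \<phi>) = \<phi>" if "\<phi> \<in> carrier (dual_group H T)" for \<phi>
  proof (rule extensionalityI[of _ "carrier H"])
    show "\<phi> \<in> extensional (carrier H)"
      using that by (simp add: carrier_dual_group_iff)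
  qed (use carrier g(1) in \<open>auto simp: dual_map_def inv hom_def\<close>)
  moreover have "dual_map G f (dual_map H g \<phi>) = \<phi>" if "\<phi> \<in> carrier (dual_group G S)" for \<phi>
  proof (rule extensionalityI[of _ "carrier G"])
    show "\<phi> \<in> extensional (carrier G)"
      using that by (simp add: carrier_dual_group_iff)
  qed (use carrier f(1) in \<open>auto simp: dual_map_def inv hom_def\<close>)
  ultimately show ?thesis
    using dual_map_hom_continuous[OF closed(1) top(1) f] dual_map_hom_continuous[OF closed(2) top(2) g]
    by (simp add: topological_group_isomorphisms_def homeomorphic_maps_def topspace_dual_topology)
qed

lemma topological_group_isomorphisms_sym:
  "topological_group_isomorphisms G S H T f g \<Longrightarrow> topological_group_isomorphisms H T G S g f"
  unfolding topological_group_isomorphisms_def using homeomorphic_maps_sym by blast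

lemma topologically_isomorphicI:
  assumes "topological_group_isomorphisms G S H T f g"
    and "topspace S = carrier G" "topspace T = carrier H"
  shows "topologically_isomorphic G S H T"
proof -
  have hm: "homeomorphic_map S T f" and "f \<in> hom G H"
    using assms(1) homeomorphic_maps_imp_map by (auto simp: topological_group_isomorphisms_def)
  moreover have "bij_betw f (carrier G) (carrier H)"
    using homeomorphic_imp_injective_map[OF hm]     homeomorphic_imp_surjective_map[OF hm] assms(2,3) by (simp add: bij_betw_def)
  ultimately show ?thesis
    unfolding topologically_isomorphic_def iso_def by blast
qed

lemma topologically_isomorphic_trans:
  assumes "topologically_isomorphic G S H T" "topologically_isomorphic H T K U"
  shows "topologically_isomorphic G S K U"
proof -
  obtain f g where "f \<in> iso G H" "homeomorphic_map S T f" "g \<in> iso H K" "homeomorphic_map T U g"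
    using assms by (auto simp: topologically_isomorphic_def)
  then have "g \<circ> f \<in> iso G K" "homeomorphic_map S U (g \<circ> f)"
    by (auto intro: iso_set_trans homeomorphic_map_compose)
  then show ?thesis
    unfolding topologically_isomorphic_def by blast
qed

text \<open>Dualising the isomorphism twice identifies the biduals, and it remains to compose with
  the given isomorphism. This allows the computation to take place among homomorphisms instead of
  compatible families.\<close>

lemma reflexive_group_transfer:
  assumes fg: "topological_group_isomorphisms G S H T f g"
    and closed: "\<And>x y. x \<in> carrier G \<Longrightarrow> y \<in> carrier G \<Longrightarrow> x \<otimes>\<^bsub>G\<^esub> y \<in> carrier G"
      "\<And>x y. x \<in> carrier H \<Longrightarrow> y \<in> carrier H \<Longrightarrow> x \<otimes>\<^bsub>H\<^esub> y \<in> carrier H"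
    and top: "topspace S = carrier G" "topspace T = carrier H"
    and refl: "reflexive_group G S"
  shows "reflexive_group H T"
proof -
  note dual = topological_group_isomorphisms_dual[OF fg closed top]
  note bidual = topological_group_isomorphisms_dual[OF dual
      dual_group_closed[OF closed(2) top(2)] dual_group_closed[OF closed(1) top(1)]
      topspace_dual_topology topspace_dual_topology]
  have "topologically_isomorphic
      (dual_group (dual_group H T) (dual_topology H T))
      (dual_topology (dual_group H T) (dual_topology H T))
      (dual_group (dual_group G S) (dual_topology G S))
      (dual_topology (dual_group G S) (dual_topology G S))"
    by (rule topologically_isomorphicI[OF topological_group_isomorphisms_sym[OF bidual]
          topspace_dual_topology topspace_dual_topology])
  moreover have "topologically_isomorphic G S H T"
    by (rule topologically_isomorphicI[OF fg top])
  ultimately show ?thesis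
    using refl unfolding reflexive_group_def by (blast intro: topologically_isomorphic_trans)
qed

section \<open>Homomorphisms with the topology of pointwise convergence\<close>

text \<open>Pointwise convergence into the discrete integers, given directly by its basic
  neighbourhoods, so that every open set yields its finite set \<open>F\<close> of sequences by
  unfolding.\<close>

definition hom_int_topology :: "((nat \<Rightarrow> int) \<Rightarrow> int) topology" where
  "hom_int_topology = topology (\<lambda>U. U \<subseteq> hom_int \<and>
     (\<forall>g\<in>U. \<exists>F. finite F \<and> {h \<in> hom_int. \<forall>a\<in>F. h a = g a} \<subseteq> U))"

lemma openin_hom_int_topology:
  "openin hom_int_topology U \<longleftrightarrow> U \<subseteq> hom_int \<and>
     (\<forall>g\<in>U. \<exists>F. finite F \<and> {h \<in> hom_int. \<forall>a\<in>F. h a = g a} \<subseteq> U)"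
proof -
  have "istopology (\<lambda>U. U \<subseteq> hom_int \<and>
     (\<forall>g\<in>U. \<exists>F. finite F \<and> {h \<in> hom_int. \<forall>a\<in>F. h a = g a} \<subseteq> U))"
    unfolding istopology_def
  proof (intro conjI allI impI ballI)
    fix U V g
    assume U: "U \<subseteq> hom_int \<and> (\<forall>g\<in>U. \<exists>F. finite F \<and> {h \<in> hom_int. \<forall>a\<in>F. h a = g a} \<subseteq> U)"
      and V: "V \<subseteq> hom_int \<and> (\<forall>g\<in>V. \<exists>F. finite F \<and> {h \<in> hom_int. \<forall>a\<in>F. h a = g a} \<subseteq> V)"
      and g: "g \<in> U \<inter> V"
    obtain E F where "finite E" "{h \<in> hom_int. \<forall>a\<in>E. h a = g a} \<subseteq> U"
      "finite F" "{h \<in> hom_int. \<forall>a\<in>F. h a = g a} \<subseteq> V"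
      using U V g by (meson IntD1 IntD2)
    then show "\<exists>F. finite F \<and> {h \<in> hom_int. \<forall>a\<in>F. h a = g a} \<subseteq> U \<inter> V"
      by (intro exI[of _ "E \<union> F"]) auto
  next
    fix \<U> g
    assume \<U>: "\<forall>U\<in>\<U>. U \<subseteq> hom_int \<and> (\<forall>g\<in>U. \<exists>F. finite F \<and> {h \<in> hom_int. \<forall>a\<in>F. h a = g a} \<subseteq> U)"
      and "g \<in> \<Union>\<U>"
    then obtain U where U: "U \<in> \<U>" "g \<in> U" by blast
    then obtain F where "finite F" "{h \<in> hom_int. \<forall>a\<in>F. h a = g a} \<subseteq> U"
      using \<U> by meson
    then show "\<exists>F. finite F \<and> {h \<in> hom_int. \<forall>a\<in>F. h a = g a} \<subseteq> \<Union>\<U>"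
      using U by (intro exI[of _ F]) blast
  qed blast+
  then show ?thesis
    by (simp add: hom_int_topology_def topology_inverse')
qed

lemma topspace_hom_int_topology [simp]: "topspace hom_int_topology = hom_int"
proof -
  have "openin hom_int_topology hom_int"
    unfolding openin_hom_int_topology by (auto intro: finite.emptyI)
  moreover have "topspace hom_int_topology \<subseteq> hom_int"
    using openin_hom_int_topology openin_topspace by blast
  ultimately show ?thesis
    using openin_subset by blast
qed

text \<open>Evaluations are continuous into a discrete space, so each takes finitely many values on
  \<open>K\<close>. This gives pointwise bounds, hence a common support bound \<open>n\<close>; then
  an element is determined by \<open>n\<close> coordinates, each with finitely many possible
  values.\<close>

lemma compactin_hom_int_topology:
  assumes "compactin hom_int_topology K"
  shows "finite K" and "\<exists>n. \<forall>g\<in>K. \<forall>k\<ge>n. g (unit_seq k) = 0"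
proof -
  have K: "K \<subseteq> hom_int"
    using assms compactin_subset_topspace by fastforce
  have fin: "finite ((\<lambda>g. g a) ` K)" for a
  proof -
    have "continuous_map hom_int_topology (discrete_topology UNIV) (\<lambda>g. g a)"
      unfolding continuous_map_def
    proof (intro conjI allI impI)
      fix V :: "int set"
      show "openin hom_int_topology {g \<in> topspace hom_int_topology. g a \<in> V}"
        unfolding openin_hom_int_topology by (auto intro!: exI[of _ "{a}"])
    qed simp
    then have "compactin (discrete_topology UNIV) ((\<lambda>g. g a) ` K)"
      using assms by (rule image_compactin[rotated])
    then show ?thesis
      by (simp add: compactin_discrete_topology)
  qed
  have "\<exists>b. \<forall>g\<in>K. \<bar>g a\<bar> \<le> b" for a
  proof -
    have "finite ((\<lambda>x. \<bar>x\<bar>) ` (\<lambda>g. g a) ` K)"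
      using fin by (rule finite_imageI)
    then show ?thesis
      by (meson bdd_above.unfold bdd_above_finite image_eqI)
  qed
  then show support: "\<exists>n. \<forall>g\<in>K. \<forall>k\<ge>n. g (unit_seq k) = 0"
    by (rule pointwise_bounded_hom_int_support[OF K])
  then obtain n where n: "\<And>g k. g \<in> K \<Longrightarrow> k \<ge> n \<Longrightarrow> g (unit_seq k) = 0"
    by blast
  let ?c = "\<lambda>g. \<lambda>k\<in>{..<n}. g (unit_seq k)"
  have "inj_on ?c K"
  proof (rule inj_onI)
    fix g h assume gh: "g \<in> K" "h \<in> K" "?c g = ?c h"
    have "g a = h a" for a
    proof -
      have "g (unit_seq k) = h (unit_seq k)" if "k < n" for k
        using fun_cong[OF gh(3), of k] that by simp
      then have "(\<Sum>k<n. g (unit_seq k) * a k) = (\<Sum>k<n. h (unit_seq k) * a k)"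
        by (intro sum.cong) auto
      moreover have "g \<in> hom_int" "h \<in> hom_int"
        using gh(1,2) K by blast+
      ultimately show ?thesis
        using hom_int_expansion[of g n a] hom_int_expansion[of h n a] n gh(1,2) by metis
    qed
    then show "g = h" by blast
  qed
  moreover have "finite (?c ` K)"
  proof (rule finite_subset)
    show "?c ` K \<subseteq> (\<Pi>\<^sub>E k\<in>{..<n}. (\<lambda>g. g (unit_seq k)) ` K)"
      by (auto split: if_splits)
    show "finite (\<Pi>\<^sub>E k\<in>{..<n}. (\<lambda>g. g (unit_seq k)) ` K)"
      using fin by (intro finite_PiE) auto
  qed
  ultimately show "finite K"
    by (rule finite_imageD[rotated])
qed

section \<open>Circle-valued homomorphisms and their coordinates\<close>

abbreviation "hom_int_group \<equiv> pointwise_group hom_int"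
abbreviation "hom_int_dual \<equiv> dual_group hom_int_group hom_int_topology"
abbreviation "hom_int_dual_topology \<equiv> dual_topology hom_int_group hom_int_topology"

context
  fixes d assumes d: "d \<in> hom hom_int_group circle_group"
begin

lemma circle_hom_closed: "g \<in> hom_int \<Longrightarrow> d g \<in> carrier circle_group"
  using d by (auto simp: hom_def)

lemma circle_hom_add:
  "g \<in> hom_int \<Longrightarrow> h \<in> hom_int \<Longrightarrow> d (\<lambda>a. g a + h a) = d g \<otimes>\<^bsub>circle_group\<^esub> d h"
  using d by (auto simp: hom_def)

lemma circle_hom_zero: "d (\<lambda>_. 0) = circle_proj 0"
proof -
  obtain t where t: "d (\<lambda>_. 0) = circle_proj t"
    using circle_hom_closed[OF zero_in_hom_int] by (rule circle_projE)
  have "circle_proj t = circle_proj (t + t)"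
    using circle_hom_add[OF zero_in_hom_int zero_in_hom_int] by (simp add: t circle_mult)
  then show ?thesis
    by (simp add: t circle_proj_eq_iff)
qed

lemma circle_hom_scale:
  assumes g: "g \<in> hom_int" and t: "d g = circle_proj t"
  shows "d (\<lambda>a. c * g a) = circle_proj (of_int c * t)"
proof -
  have nat: "d (\<lambda>a. int n * g a) = circle_proj (real n * t)" for n
  proof (induction n)
    case (Suc n)
    have "d (\<lambda>a. g a + int n * g a) = circle_proj (t + real n * t)"
      using circle_hom_add[OF g hom_int_cmult[OF g, of "int n"]] by (simp add: Suc t circle_mult)
    then show ?case by (simp add: distrib_right)
  qed (simp add: circle_hom_zero)
  show ?thesis
  proof (cases "c \<ge> 0")
    case True
    then show ?thesis using nat[of "nat c"] by simp
  next
    case False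
    obtain s where s: "d (\<lambda>a. c * g a) = circle_proj s"
      using circle_hom_closed[OF hom_int_cmult[OF g]] by (rule circle_projE)
    have "circle_proj (s + real (nat (- c)) * t) = circle_proj 0"
      using circle_hom_add[OF hom_int_cmult[OF g, of c] hom_int_cmult[OF g, of "int (nat (- c))"]]
        nat[of "nat (- c)"] False by (simp add: s circle_mult circle_hom_zero)
    then show ?thesis
      using False by (simp add: s circle_proj_eq_iff)
  qed
qed

lemma circle_hom_combination:
  assumes "finite B" and "\<And>b. b \<in> B \<Longrightarrow> \<gamma> b \<in> hom_int" and "\<And>b. b \<in> B \<Longrightarrow> d (\<gamma> b) = circle_proj (t b)"
  shows "d (\<lambda>a. \<Sum>b\<in>B. c b * \<gamma> b a) = circle_proj (\<Sum>b\<in>B. of_int (c b) * t b)"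
  using assms
proof (induction B rule: finite_induct)
  case (insert b B)
  have b: "(\<lambda>a. c b * \<gamma> b a) \<in> hom_int" "d (\<lambda>a. c b * \<gamma> b a) = circle_proj (of_int (c b) * t b)"
    using insert.prems by (simp_all add: hom_int_cmult circle_hom_scale)
  have "(\<lambda>a. \<Sum>b\<in>B. c b * \<gamma> b a) \<in> hom_int"
    using insert.prems(1) by (intro hom_int_sums hom_int_cmult) simp
  from circle_hom_add[OF b(1) this] show ?case
    using insert by (simp add: b(2) circle_mult)
qed (simp add: circle_hom_zero)

lemma circle_hom_expansion:
  assumes "g \<in> hom_int" and "\<And>k. k \<ge> n \<Longrightarrow> g (unit_seq k) = 0"
    and "\<And>k. k < n \<Longrightarrow> d (\<lambda>a. a k) = circle_proj (t k)"
  shows "d g = circle_proj (\<Sum>k<n. of_int (g (unit_seq k)) * t k)"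
proof -
  have "g = (\<lambda>a. \<Sum>k<n. g (unit_seq k) * a k)"
    using hom_int_expansion[OF assms(1,2)] by blast
  moreover have "d (\<lambda>a. \<Sum>k<n. g (unit_seq k) * a k) = circle_proj (\<Sum>k<n. of_int (g (unit_seq k)) * t k)"
    using assms(3) by (intro circle_hom_combination) (auto simp: hom_int_coordinate)
  ultimately show ?thesis by simp
qed

end

text \<open>By Specker's theorem the coordinate functionals generate \<open>hom_int\<close>, so
  agreement on them suffices, with no appeal to continuity.\<close>

lemma circle_hom_eqI:
  assumes "d \<in> hom hom_int_group circle_group" "e \<in> hom hom_int_group circle_group"
    and eq: "\<And>k. d (\<lambda>a. a k) = e (\<lambda>a. a k)" and g: "g \<in> hom_int"
  shows "d g = e g"
proof -
  have "\<exists>t. d (\<lambda>a. a k) = circle_proj t" for k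
    using circle_hom_closed[OF assms(1) hom_int_coordinate] circle_projE by metis
  then obtain t where t: "\<And>k. d (\<lambda>a. a k) = circle_proj (t k)"
    by metis
  obtain n where n: "\<And>k. k \<ge> n \<Longrightarrow> g (unit_seq k) = 0"
    using pointwise_bounded_hom_int_support[of "{g}"] g by auto
  show ?thesis
    using circle_hom_expansion[OF assms(1) g, OF n, of n t] circle_hom_expansion[OF assms(2) g, OF n, of n t] t eq
    by simp
qed

text \<open>The second clause expresses continuity: the annihilator of a finite set is an open
  subgroup, and an additive real-valued map that is bounded on a subgroup vanishes there.\<close>

definition continuous_functional :: "(((nat \<Rightarrow> int) \<Rightarrow> int) \<Rightarrow> real) \<Rightarrow> bool" where
  "continuous_functional \<mu> \<longleftrightarrow>
     (\<forall>g\<in>hom_int. \<forall>h\<in>hom_int. \<mu> (\<lambda>a. g a + h a) = \<mu> g + \<mu> h) \<and>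
     (\<exists>F. finite F \<and> (\<forall>g\<in>hom_int. (\<forall>a\<in>F. g a = 0) \<longrightarrow> \<mu> g = 0))"

lemma continuous_functional_add:
  "continuous_functional \<mu> \<Longrightarrow> g \<in> hom_int \<Longrightarrow> h \<in> hom_int \<Longrightarrow> \<mu> (\<lambda>a. g a + h a) = \<mu> g + \<mu> h"
  by (simp add: continuous_functional_def)

lemma continuous_functionalE:
  assumes "continuous_functional \<mu>"
  obtains F where "finite F" "\<forall>g\<in>hom_int. (\<forall>a\<in>F. g a = 0) \<longrightarrow> \<mu> g = 0"
  using assms[unfolded continuous_functional_def, THEN conjunct2] by (elim exE conjE) (rule that)

lemma continuous_functionalI:
  assumes "\<And>g h. g \<in> hom_int \<Longrightarrow> h \<in> hom_int \<Longrightarrow> \<mu> (\<lambda>a. g a + h a) = \<mu> g + \<mu> h"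
    and "finite F" and "\<And>g. g \<in> hom_int \<Longrightarrow> (\<And>a. a \<in> F \<Longrightarrow> g a = 0) \<Longrightarrow> \<mu> g = 0"
  shows "continuous_functional \<mu>"
  unfolding continuous_functional_def using assms by (intro conjI exI[of _ F]) simp_all

text \<open>Real coefficients are the point: unlike characters, functionals can be halved.\<close>

lemma continuous_functional_combination:
  assumes \<mu>: "continuous_functional \<mu>" and \<nu>: "continuous_functional \<nu>"
  shows "continuous_functional (\<lambda>g. x * \<mu> g + y * \<nu> g)"
proof -
  obtain E where E: "finite E" "\<forall>g\<in>hom_int. (\<forall>a\<in>E. g a = 0) \<longrightarrow> \<mu> g = 0"
    using \<mu> by (rule continuous_functionalE)
  obtain F where F: "finite F" "\<forall>g\<in>hom_int. (\<forall>a\<in>F. g a = 0) \<longrightarrow> \<nu> g = 0"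
    using \<nu> by (rule continuous_functionalE)
  show ?thesis
  proof (rule continuous_functionalI[of _ "E \<union> F"])
    show "x * \<mu> (\<lambda>a. g a + h a) + y * \<nu> (\<lambda>a. g a + h a) = x * \<mu> g + y * \<nu> g + (x * \<mu> h + y * \<nu> h)"
      if "g \<in> hom_int" "h \<in> hom_int" for g h
      unfolding continuous_functional_add[OF \<mu> that] continuous_functional_add[OF \<nu> that]
      by (simp add: distrib_left)
    show "x * \<mu> g + y * \<nu> g = 0" if "g \<in> hom_int" "\<And>a. a \<in> E \<union> F \<Longrightarrow> g a = 0" for g
      using E(2) F(2) that by simp
  qed (use E(1) F(1) in simp)
qed

lemma continuous_functional_evaluation: "continuous_functional (\<lambda>g. of_int (g s))"
  by (rule continuous_functionalI[of _ "{s}"]) simp_all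

definition character :: "(((nat \<Rightarrow> int) \<Rightarrow> int) \<Rightarrow> real) \<Rightarrow> ((nat \<Rightarrow> int) \<Rightarrow> int) \<Rightarrow> real set" where
  "character \<mu> = (\<lambda>g\<in>hom_int. circle_proj (\<mu> g))"

lemma character_in_dual:
  assumes "continuous_functional \<mu>" shows "character \<mu> \<in> carrier hom_int_dual"
proof -
  note add = continuous_functional_add[OF assms]
  obtain F where F: "finite F" "\<forall>g\<in>hom_int. (\<forall>a\<in>F. g a = 0) \<longrightarrow> \<mu> g = 0"
    using assms by (rule continuous_functionalE)
  have local_const: "\<mu> h = \<mu> g" if "g \<in> hom_int" "h \<in> hom_int" "\<And>a. a \<in> F \<Longrightarrow> h a = g a" for g h
    using add[OF that(1) hom_int_minus[OF that(2,1)]] F(2)[rule_format, OF hom_int_minus[OF that(2,1)]]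
      that(3) by simp
  have "character \<mu> \<in> hom hom_int_group circle_group"
    by (auto simp: hom_def character_def add hom_int_add circle_mult)
  moreover have "continuous_map hom_int_topology circle_topology (character \<mu>)"
    unfolding continuous_map_def
  proof (intro conjI allI impI)
    show "character \<mu> \<in> topspace hom_int_topology \<rightarrow> topspace circle_topology"
      by (auto simp: character_def topspace_circle_topology)
    fix U
    show "openin hom_int_topology {g \<in> topspace hom_int_topology. character \<mu> g \<in> U}"
      unfolding openin_hom_int_topology
    proof (intro conjI ballI)
      fix g assume g: "g \<in> {g \<in> topspace hom_int_topology. character \<mu> g \<in> U}"
      have "h \<in> {g \<in> topspace hom_int_topology. character \<mu> g \<in> U}"
        if h: "h \<in> {h \<in> hom_int. \<forall>a\<in>F. h a = g a}" for h
      proof -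
        have "\<mu> h = \<mu> g"
          using g h by (intro local_const) simp_all
        then show ?thesis
          using g h by (simp add: character_def split: if_splits)
      qed
      then show "\<exists>F. finite F \<and> {h \<in> hom_int. \<forall>a\<in>F. h a = g a}
          \<subseteq> {g \<in> topspace hom_int_topology. character \<mu> g \<in> U}"
        using F(1) by (intro exI[of _ F] conjI subsetI)
    qed auto
  qed
  ultimately show ?thesis
    by (simp add: carrier_dual_group_iff) (simp add: character_def)
qed

text \<open>Restriction to \<open>F\<close> is encoded as extension by zero, so that the
  restrictions to all sets \<open>F\<close> have one type and composing restrictions gives
  equalities of total functions.\<close>

definition cut_off :: "'b set \<Rightarrow> ('b \<Rightarrow> int) \<Rightarrow> 'b \<Rightarrow> int" where
  "cut_off F g = (\<lambda>a. if a \<in> F then g a else 0)"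

lemma additive_subgroup_cut: "additive_subgroup (cut_off F ` hom_int)"
  unfolding additive_subgroup_def
proof (intro conjI ballI)
  show "(\<lambda>_. 0) \<in> cut_off F ` hom_int"
    by (intro image_eqI[OF _ zero_in_hom_int]) (auto simp: cut_off_def)
  fix x y assume "x \<in> cut_off F ` hom_int" "y \<in> cut_off F ` hom_int"
  then obtain g h where "g \<in> hom_int" "h \<in> hom_int" "x = cut_off F g" "y = cut_off F h"
    by blast
  then show "(\<lambda>a. x a - y a) \<in> cut_off F ` hom_int"
    by (intro image_eqI[of _ _ "\<lambda>a. g a - h a"]) (auto simp: cut_off_def hom_int_minus)
qed

lemma exists_int_basis_cut:
  assumes "finite F" shows "\<exists>B. int_basis B (cut_off F ` hom_int)"
  using assms additive_subgroup_cut by (rule exists_int_basis) (auto simp: cut_off_def)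

text \<open>Continuity at zero makes \<open>d\<close> small on the annihilator of some finite
  \<open>F\<close>. That annihilator is a subgroup, so all multiples of a value of \<open>d\<close>
  on it stay in the arc, and the circle has no small nontrivial subgroups.\<close>

lemma dual_kills_annihilator:
  assumes d: "d \<in> carrier hom_int_dual"
  obtains F where "finite F" "\<And>g. g \<in> hom_int \<Longrightarrow> (\<And>a. a \<in> F \<Longrightarrow> g a = 0) \<Longrightarrow> d g = circle_proj 0"
proof -
  have hom: "d \<in> hom hom_int_group circle_group" and cont: "continuous_map hom_int_topology circle_topology d"
    using d by (auto simp: carrier_dual_group_iff)
  have "openin hom_int_topology {g \<in> hom_int. d g \<in> circle_arc 0 (1/4)}"
    using openin_continuous_map_preimage[OF cont openin_circle_arc] by simp
  moreover have "(\<lambda>_. 0) \<in> {g \<in> hom_int. d g \<in> circle_arc 0 (1/4)}"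
    by (simp add: zero_in_hom_int circle_hom_zero[OF hom] circle_proj_in_arc)
  ultimately obtain F where F: "finite F"
    "{h \<in> hom_int. \<forall>a\<in>F. h a = 0} \<subseteq> {g \<in> hom_int. d g \<in> circle_arc 0 (1/4)}"
    unfolding openin_hom_int_topology by meson
  have "d g = circle_proj 0" if g: "g \<in> hom_int" "\<And>a. a \<in> F \<Longrightarrow> g a = 0" for g
  proof -
    obtain t where t: "d g = circle_proj t"
      using circle_hom_closed[OF hom g(1)] by (rule circle_projE)
    have "circle_proj (real n * t) \<in> circle_arc 0 (1/4)" for n
    proof -
      have "(\<lambda>a. int n * g a) \<in> {h \<in> hom_int. \<forall>a\<in>F. h a = 0}"
        using g by (simp add: hom_int_cmult)
      then have "d (\<lambda>a. int n * g a) \<in> circle_arc 0 (1/4)"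
        using F(2) by blast
      then show ?thesis
        using circle_hom_scale[OF hom g(1), OF t, of "int n"] by simp
    qed
    then show ?thesis
      unfolding t by (simp add: circle_no_small_subgroups circle_one[symmetric])
  qed
  with F(1) show thesis by (rule that)
qed

text \<open>Since \<open>d\<close> is trivial on the annihilator of a finite \<open>F\<close>, it
  depends only on restrictions to \<open>F\<close>. These form a free group of finite rank, where
  real representatives of the values on a basis extend additively.\<close>

lemma dual_lift:
  assumes d: "d \<in> carrier hom_int_dual"
  obtains \<mu> where "continuous_functional \<mu>" "d = character \<mu>"
proof -
  have hom: "d \<in> hom hom_int_group circle_group" and ext_d: "d \<in> extensional hom_int"
    using d by (auto simp: carrier_dual_group_iff)
  obtain F where F: "finite F" "\<And>g. g \<in> hom_int \<Longrightarrow> (\<And>a. a \<in> F \<Longrightarrow> g a = 0) \<Longrightarrow> d g = circle_proj 0"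
    using dual_kills_annihilator[OF d] by blast
  obtain B where B: "int_basis B (cut_off F ` hom_int)"
    using exists_int_basis_cut[OF F(1)] by blast
  then have fin: "finite B" and sub: "B \<subseteq> cut_off F ` hom_int"
    and span: "\<forall>x\<in>cut_off F ` hom_int. \<exists>k. x = (\<lambda>a. \<Sum>b\<in>B. k b * b a)"
    by (simp_all add: int_basis_def)
  have "\<forall>b\<in>B. \<exists>g\<in>hom_int. b = cut_off F g"
    using sub by blast
  then obtain \<gamma> where \<gamma>: "\<And>b. b \<in> B \<Longrightarrow> \<gamma> b \<in> hom_int" "\<And>b. b \<in> B \<Longrightarrow> b = cut_off F (\<gamma> b)"
    by metis
  have "\<exists>t. d (\<gamma> b) = circle_proj t" if "b \<in> B" for b
    using circle_hom_closed[OF hom \<gamma>(1)[OF that]] circle_projE by metis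
  then obtain t where t: "\<And>b. b \<in> B \<Longrightarrow> d (\<gamma> b) = circle_proj (t b)"
    by metis
  have "\<forall>g. \<exists>k. g \<in> hom_int \<longrightarrow> cut_off F g = (\<lambda>a. \<Sum>b\<in>B. k b * b a)"
    using span by blast
  from choice[OF this] obtain k
    where "\<forall>g. g \<in> hom_int \<longrightarrow> cut_off F g = (\<lambda>a. \<Sum>b\<in>B. k g b * b a)" ..
  then have k: "(\<Sum>b\<in>B. k g b * b a) = cut_off F g a" if "g \<in> hom_int" for g a
    using that by simp
  define \<mu> where "\<mu> g = (\<Sum>b\<in>B. of_int (k g b) * t b)" for g
  have "\<mu> (\<lambda>a. g a + h a) = \<mu> g + \<mu> h" if gh: "g \<in> hom_int" "h \<in> hom_int" for g h
  proof -
    \<comment> \<open>The coefficients \<open>k g\<close> were merely chosen; independence of the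
      basis forces the choice to be additive in \<open>g\<close>.\<close>
    have "k (\<lambda>a. g a + h a) b = k g b + k h b" if "b \<in> B" for b
    proof (rule int_basis_unique[OF B _ that])
      fix a
      show "(\<Sum>b\<in>B. k (\<lambda>a. g a + h a) b * b a) = (\<Sum>b\<in>B. (k g b + k h b) * b a)"
        by (simp add: k hom_int_add gh distrib_right sum.distrib) (simp add: cut_off_def)
    qed
    then show ?thesis
      by (simp add: \<mu>_def distrib_right sum.distrib)
  qed
  moreover have "\<mu> g = 0" if g: "g \<in> hom_int" "\<forall>a\<in>F. g a = 0" for g
  proof -
    have "(\<Sum>b\<in>B. k g b * b a) = 0" for a
      unfolding k[OF g(1)] using g(2) by (simp add: cut_off_def)
    then have "k g b = 0" if "b \<in> B" for b
      by (rule int_basis_independent[OF B _ that])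
    then show ?thesis by (simp add: \<mu>_def)
  qed
  ultimately have \<mu>: "continuous_functional \<mu>"
    by (intro continuous_functionalI[OF _ F(1)]) simp_all
  have val: "d g = circle_proj (\<mu> g)" if g: "g \<in> hom_int" for g
  proof -
    \<comment> \<open>This combination of preimages of basis elements agrees with \<open>g\<close>
      on \<open>F\<close> but possibly nowhere else; the discrepancy is killed by
      \<open>d\<close>.\<close>
    let ?h = "\<lambda>a. \<Sum>b\<in>B. k g b * \<gamma> b a"
    have h: "?h \<in> hom_int"
      using \<gamma>(1) by (intro hom_int_sums hom_int_cmult)
    have "?h a = g a" if "a \<in> F" for a
    proof -
      have "?h a = (\<Sum>b\<in>B. k g b * b a)"
      proof (rule sum.cong)
        fix b assume "b \<in> B"
        then have "b a = \<gamma> b a"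
          using fun_cong[OF \<gamma>(2), of b a] \<open>a \<in> F\<close> by (simp add: cut_off_def)
        then show "k g b * \<gamma> b a = k g b * b a" by simp
      qed simp
      then show ?thesis
        using k[OF g, of a] that by (simp add: cut_off_def)
    qed
    then have "d (\<lambda>a. g a - ?h a) = circle_proj 0"
      by (intro F(2) hom_int_minus g h) simp
    moreover have "d ?h = circle_proj (\<mu> g)"
      unfolding \<mu>_def by (rule circle_hom_combination[OF hom fin, OF \<gamma>(1), OF _ t])
    ultimately show ?thesis
      using circle_hom_add[OF hom h hom_int_minus[OF g h]] by (simp add: circle_mult)
  qed
  have "d g = character \<mu> g" for g
    by (cases "g \<in> hom_int") (simp_all add: character_def val extensional_arb[OF ext_d])
  then have "d = character \<mu>" ..
  with \<mu> show thesis by (rule that)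
qed

section \<open>The topology of the dual\<close>

lemma dual_hom: "d \<in> carrier hom_int_dual \<Longrightarrow> d \<in> hom hom_int_group circle_group"
  by (simp add: carrier_dual_group_iff)

lemma dual_closed:
  "d \<in> carrier hom_int_dual \<Longrightarrow> e \<in> carrier hom_int_dual \<Longrightarrow> d \<otimes>\<^bsub>hom_int_dual\<^esub> e \<in> carrier hom_int_dual"
  by (rule dual_group_closed) (simp_all add: hom_int_add)

lemma dual_eqI:
  assumes d: "d \<in> carrier hom_int_dual" and e: "e \<in> carrier hom_int_dual"
    and "\<And>k. d (\<lambda>a. a k) = e (\<lambda>a. a k)"
  shows "d = e"
proof (rule extensionalityI)
  show "d \<in> extensional hom_int" "e \<in> extensional hom_int"
    using d e by (simp_all add: carrier_dual_group_iff)
  show "d g = e g" if "g \<in> hom_int" for g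
    by (rule circle_hom_eqI[OF dual_hom[OF d] dual_hom[OF e] assms(3) that])
qed

lemma dual_coordinates:
  assumes "d \<in> carrier hom_int_dual"
  obtains t where "\<And>k. d (\<lambda>a. a k) = circle_proj (t k)"
proof -
  have "\<forall>k. \<exists>t. d (\<lambda>a. a k) = circle_proj t"
    using circle_hom_closed[OF dual_hom[OF assms] hom_int_coordinate] circle_projE by metis
  from choice[OF this] show thesis
    using that by blast
qed

lemma dual_mult_coordinate:
  "(d \<otimes>\<^bsub>hom_int_dual\<^esub> e) (\<lambda>a. a k) = d (\<lambda>a. a k) \<otimes>\<^bsub>circle_group\<^esub> e (\<lambda>a. a k)"
  by (simp add: dual_group_mult hom_int_coordinate)

lemma dual_square_mult:
  assumes "d \<in> carrier hom_int_dual" "e \<in> carrier hom_int_dual"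
  shows "(d \<otimes>\<^bsub>hom_int_dual\<^esub> e) \<otimes>\<^bsub>hom_int_dual\<^esub> (d \<otimes>\<^bsub>hom_int_dual\<^esub> e)
    = (d \<otimes>\<^bsub>hom_int_dual\<^esub> d) \<otimes>\<^bsub>hom_int_dual\<^esub> (e \<otimes>\<^bsub>hom_int_dual\<^esub> e)"
proof -
  interpret comm_group circle_group
    by (rule comm_group_circle_group)
  show ?thesis
    using circle_hom_closed[OF dual_hom[OF assms(1)]] circle_hom_closed[OF dual_hom[OF assms(2)]]
    unfolding dual_group_mult by (intro ext) (simp add: restrict_def m_ac)
qed

lemma character_mult:
  "character \<mu> \<otimes>\<^bsub>hom_int_dual\<^esub> character \<nu> = character (\<lambda>g. \<mu> g + \<nu> g)"
  unfolding dual_group_mult by (intro ext) (simp add: restrict_def character_def circle_mult)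

text \<open>Halves of finitely many coordinates can be prescribed; this makes doubling an open map.\<close>

lemma dual_square_root:
  assumes d: "d \<in> carrier hom_int_dual"
    and \<eta>: "\<And>k. k < n \<Longrightarrow> d (\<lambda>a. a k) = circle_proj (2 * \<eta> k)"
  obtains e where "e \<in> carrier hom_int_dual" "e \<otimes>\<^bsub>hom_int_dual\<^esub> e = d"
    "\<And>k. k < n \<Longrightarrow> e (\<lambda>a. a k) = circle_proj (\<eta> k)"
proof -
  obtain \<mu> where \<mu>: "continuous_functional \<mu>" "d = character \<mu>"
    using d by (rule dual_lift)
  have "\<forall>k. \<exists>m. k < n \<longrightarrow> \<mu> (\<lambda>a. a k) - 2 * \<eta> k = of_int m"
  proof
    fix k
    have "\<mu> (\<lambda>a. a k) - 2 * \<eta> k \<in> \<int>" if "k < n"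
      using \<eta>[OF that] by (simp add: \<mu>(2) character_def hom_int_coordinate circle_proj_eq_iff)
    then show "\<exists>m. k < n \<longrightarrow> \<mu> (\<lambda>a. a k) - 2 * \<eta> k = of_int m"
      by (auto elim: Ints_cases)
  qed
  from choice[OF this] obtain s :: "nat \<Rightarrow> int"
    where s: "\<And>k. k < n \<Longrightarrow> \<mu> (\<lambda>a. a k) - 2 * \<eta> k = of_int (s k)"
    by blast
  \<comment> \<open>Evaluation at \<open>s\<close> is integral, so subtracting half of it leaves the
    double equal to \<open>d\<close>, and at coordinate \<open>k < n\<close> it moves half of the
    lift to exactly \<open>\<eta> k\<close>.\<close>
  define \<nu> where "\<nu> = (\<lambda>g. 1/2 * \<mu> g + (- 1/2) * of_int (g s))"
  have "continuous_functional \<nu>"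
    unfolding \<nu>_def by (intro continuous_functional_combination continuous_functional_evaluation \<mu>(1))
  moreover have "circle_proj (\<nu> g + \<nu> g) = circle_proj (\<mu> g)" for g
    by (simp add: \<nu>_def circle_proj_eq_iff)
  then have "character \<nu> \<otimes>\<^bsub>hom_int_dual\<^esub> character \<nu> = d"
    by (simp add: character_mult \<mu>(2)) (simp add: character_def)
  moreover have "character \<nu> (\<lambda>a. a k) = circle_proj (\<eta> k)" if "k < n" for k
  proof -
    have "\<nu> (\<lambda>a. a k) = \<eta> k"
      using s[OF that] by (simp add: \<nu>_def)
    then show ?thesis
      by (simp add: character_def hom_int_coordinate)
  qed
  ultimately show thesis
    by (intro that[of "character \<nu>"] character_in_dual)
qed

section \<open>Coordinate boxes as neighbourhoods in the dual\<close>

definition dual_box :: "(nat \<Rightarrow> real) \<Rightarrow> nat \<Rightarrow> real \<Rightarrow> (((nat \<Rightarrow> int) \<Rightarrow> int) \<Rightarrow> real set) set" where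
  "dual_box t n \<epsilon> = {e \<in> carrier hom_int_dual. \<forall>k<n. e (\<lambda>a. a k) \<in> circle_arc (t k) \<epsilon>}"

lemma circle_arc_mono: "\<delta> \<le> \<epsilon> \<Longrightarrow> circle_arc x \<delta> \<subseteq> circle_arc x \<epsilon>"
  unfolding circle_arc_def by (intro image_mono) auto

lemma dual_box_mono: "m \<le> n \<Longrightarrow> \<delta> \<le> \<epsilon> \<Longrightarrow> dual_box t n \<delta> \<subseteq> dual_box t m \<epsilon>"
  using circle_arc_mono[of \<delta> \<epsilon>] unfolding dual_box_def by (auto dest: order_less_le_trans)

lemma dual_box_coordinates:
  assumes "e \<in> dual_box t n \<epsilon>"
  obtains u where "\<And>k. k < n \<Longrightarrow> e (\<lambda>a. a k) = circle_proj (u k)" "\<And>k. k < n \<Longrightarrow> \<bar>u k - t k\<bar> < \<epsilon>"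
proof -
  have "\<forall>k. \<exists>u. k < n \<longrightarrow> e (\<lambda>a. a k) = circle_proj u \<and> \<bar>u - t k\<bar> < \<epsilon>"
  proof
    fix k
    show "\<exists>u. k < n \<longrightarrow> e (\<lambda>a. a k) = circle_proj u \<and> \<bar>u - t k\<bar> < \<epsilon>"
    proof (cases "k < n")
      case True
      then have "e (\<lambda>a. a k) \<in> circle_arc (t k) \<epsilon>"
        using assms by (simp add: dual_box_def)
      then show ?thesis by (rule circle_arcE) blast
    qed simp
  qed
  from choice[OF this] show thesis
    using that by blast
qed

lemma openin_dual_box: "openin hom_int_dual_topology (dual_box t n \<epsilon>)"
proof (induction n)
  case 0
  then show ?case
    using openin_topspace[of hom_int_dual_topology] by (simp add: dual_box_def topspace_dual_topology)
next
  case (Suc n)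
  have "compactin hom_int_topology {\<lambda>a. a n}"
    by (simp add: hom_int_coordinate)
  then have "openin hom_int_dual_topology
      {e \<in> carrier hom_int_dual. e ` {\<lambda>a. a n} \<subseteq> circle_arc (t n) \<epsilon>}"
    by (rule openin_dual_topology_subbase[OF _ openin_circle_arc])
  from openin_Int[OF Suc this] show ?case
    by (rule back_subst[of "openin _"]) (auto simp: dual_box_def less_Suc_eq)
qed

text \<open>The value \<open>e g\<close> is an integer combination of the first \<open>n\<close>
  coordinates of \<open>e\<close>, so it depends on them in a Lipschitz manner, with the sum of the
  absolute coefficients as constant.\<close>

lemma dual_box_evaluation:
  assumes U: "openin circle_topology U" and g: "g \<in> hom_int" "\<And>k. k \<ge> n \<Longrightarrow> g (unit_seq k) = 0"
    and d: "d \<in> carrier hom_int_dual" "\<And>k. d (\<lambda>a. a k) = circle_proj (t k)" "d g \<in> U"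
  obtains \<epsilon> where "\<epsilon> > 0" "\<And>e. e \<in> dual_box t n \<epsilon> \<Longrightarrow> e g \<in> U"
proof -
  have val: "e g = circle_proj (\<Sum>k<n. of_int (g (unit_seq k)) * u k)"
    if "e \<in> carrier hom_int_dual" "\<And>k. k < n \<Longrightarrow> e (\<lambda>a. a k) = circle_proj (u k)" for e u
    using circle_hom_expansion[OF dual_hom[OF that(1)] g(1), of n u] g(2) that(2) by simp
  obtain \<delta> where \<delta>: "\<delta> > 0"
    "\<And>y. \<bar>y - (\<Sum>k<n. of_int (g (unit_seq k)) * t k)\<bar> < \<delta> \<Longrightarrow> circle_proj y \<in> U"
    using d(3) openin_circle_ball[OF U] unfolding val[OF d(1,2)] by metis
  \<comment> \<open>Adding one to the Lipschitz constant keeps \<open>C\<close> positive when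
    \<open>g\<close> is zero and makes the final estimate
    \<open>(C - 1) * (\<delta> / C) < \<delta>\<close> strict.\<close>
  define C where "C = (\<Sum>k<n. \<bar>of_int (g (unit_seq k)) :: real\<bar>) + 1"
  have "(\<Sum>k<n. \<bar>of_int (g (unit_seq k)) :: real\<bar>) \<ge> 0"
    by (rule sum_nonneg) simp
  then have C: "C > 0"
    unfolding C_def by linarith
  have "e g \<in> U" if e: "e \<in> dual_box t n (\<delta> / C)" for e
  proof -
    obtain u where u: "\<And>k. k < n \<Longrightarrow> e (\<lambda>a. a k) = circle_proj (u k)"
      "\<And>k. k < n \<Longrightarrow> \<bar>u k - t k\<bar> < \<delta> / C"
      using e by (rule dual_box_coordinates) blast
    have "\<bar>(\<Sum>k<n. of_int (g (unit_seq k)) * u k) - (\<Sum>k<n. of_int (g (unit_seq k)) * t k)\<bar>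
        = \<bar>\<Sum>k<n. of_int (g (unit_seq k)) * (u k - t k)\<bar>"
      by (simp add: sum_subtractf right_diff_distrib)
    also have "\<dots> \<le> (\<Sum>k<n. \<bar>of_int (g (unit_seq k))\<bar> * (\<delta> / C))"
    proof (rule order_trans[OF sum_abs sum_mono])
      fix k assume "k \<in> {..<n}"
      then have "\<bar>u k - t k\<bar> \<le> \<delta> / C"
        using u(2)[of k] by simp
      then show "\<bar>of_int (g (unit_seq k)) * (u k - t k)\<bar> \<le> \<bar>of_int (g (unit_seq k))\<bar> * (\<delta> / C)"
        unfolding abs_mult by (rule mult_left_mono) simp
    qed
    also have "\<dots> = (C - 1) * (\<delta> / C)"
      by (simp add: C_def sum_distrib_right sum_divide_distrib)
    also have "\<dots> < \<delta>"
      using C \<delta>(1) by (simp add: field_simps)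
    finally have "circle_proj (\<Sum>k<n. of_int (g (unit_seq k)) * u k) \<in> U"
      by (rule \<delta>(2))
    moreover have "e \<in> carrier hom_int_dual"
      using e by (simp add: dual_box_def)
    ultimately show ?thesis
      using val u(1) by simp
  qed
  moreover have "\<delta> / C > 0"
    using \<delta>(1) C by simp
  ultimately show thesis
    using that by blast
qed

text \<open>A subbasic set given by a compact \<open>K\<close> imposes finitely many conditions, all
  on the same first \<open>n\<close> coordinates, so the smallest of the radii works. Together with
  \<open>openin_dual_box\<close> this identifies the compact-open topology with pointwise
  convergence on coordinates.\<close>

lemma dual_box_subset_open:
  assumes "openin hom_int_dual_topology M" and "d \<in> M" and t: "\<And>k. d (\<lambda>a. a k) = circle_proj (t k)"
  shows "\<exists>n \<epsilon>. \<epsilon> > 0 \<and> dual_box t n \<epsilon> \<subseteq> M"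
proof -
  let ?B = "{{f \<in> carrier hom_int_dual. f ` K \<subseteq> U} | K U.
    compactin hom_int_topology K \<and> openin circle_topology U}"
  have "generate_topology_on ?B M"
    using assms(1) unfolding dual_topology_def by (rule openin_topology_generated_by)
  then show ?thesis
    using assms(2)
  proof (induction rule: generate_topology_on.induct)
    case (Int M N)
    then obtain m \<delta> n \<epsilon> where box: "\<delta> > 0" "dual_box t m \<delta> \<subseteq> M" "\<epsilon> > 0" "dual_box t n \<epsilon> \<subseteq> N"
      by blast
    have "dual_box t (max m n) (min \<delta> \<epsilon>) \<subseteq> M \<inter> N"
      using box(2,4) dual_box_mono[of m "max m n" "min \<delta> \<epsilon>" \<delta> t] dual_box_mono[of n "max m n" "min \<delta> \<epsilon>" \<epsilon> t]
      by auto
    then show ?case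
      using box(1,3) by (intro exI[of _ "max m n"] exI[of _ "min \<delta> \<epsilon>"]) simp
  next
    case (UN \<M>)
    then obtain N n \<epsilon> where "N \<in> \<M>" "\<epsilon> > 0" "dual_box t n \<epsilon> \<subseteq> N"
      by blast
    then show ?case
      by (intro exI[of _ n] exI[of _ \<epsilon>]) blast
  next
    case (Basis M)
    then obtain K U where K: "compactin hom_int_topology K" and U: "openin circle_topology U"
      and M: "M = {f \<in> carrier hom_int_dual. f ` K \<subseteq> U}"
      by blast
    have K_sub: "K \<subseteq> hom_int"
      using compactin_subset_topspace[OF K] by simp
    obtain n where n: "\<And>g k. g \<in> K \<Longrightarrow> k \<ge> n \<Longrightarrow> g (unit_seq k) = 0"
      using compactin_hom_int_topology(2)[OF K] by blast
    have d: "d \<in> carrier hom_int_dual" "\<And>g. g \<in> K \<Longrightarrow> d g \<in> U"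
      using Basis.prems M by auto
    have "\<forall>g. \<exists>\<epsilon>. g \<in> K \<longrightarrow> \<epsilon> > 0 \<and> (\<forall>e\<in>dual_box t n \<epsilon>. e g \<in> U)"
    proof
      fix g
      show "\<exists>\<epsilon>. g \<in> K \<longrightarrow> \<epsilon> > 0 \<and> (\<forall>e\<in>dual_box t n \<epsilon>. e g \<in> U)"
      proof (cases "g \<in> K")
        case True
        then have "g \<in> hom_int" using K_sub by blast
        note evaluation = dual_box_evaluation[OF U this, where n = n and d = d and t = t]
        obtain \<epsilon> where "\<epsilon> > 0" "\<And>e. e \<in> dual_box t n \<epsilon> \<Longrightarrow> e g \<in> U"
          using evaluation[OF n[OF True] d(1) t d(2)[OF True]] by blast
        then show ?thesis by blast
      qed simp
    qed
    from choice[OF this] obtain \<epsilon> where \<epsilon>: "\<And>g. g \<in> K \<Longrightarrow> \<epsilon> g > 0"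
      "\<And>g e. g \<in> K \<Longrightarrow> e \<in> dual_box t n (\<epsilon> g) \<Longrightarrow> e g \<in> U"
      by blast
    \<comment> \<open>The extra element 1 keeps the minimum meaningful when \<open>K\<close> is
      empty.\<close>
    define \<delta> where "\<delta> = Min (insert 1 (\<epsilon> ` K))"
    have fin: "finite (insert 1 (\<epsilon> ` K))"
      using compactin_hom_int_topology(1)[OF K] by simp
    have \<delta>: "\<delta> > 0" "\<And>g. g \<in> K \<Longrightarrow> \<delta> \<le> \<epsilon> g"
      unfolding \<delta>_def using fin \<epsilon>(1) by auto
    have "e g \<in> U" if "e \<in> dual_box t n \<delta>" "g \<in> K" for e g
      using \<epsilon>(2)[OF that(2)] dual_box_mono[OF order_refl \<delta>(2)[OF that(2)]] that(1) by blast
    then have "dual_box t n \<delta> \<subseteq> M"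
      unfolding M by (auto simp: dual_box_def)
    then show ?case
      using \<delta>(1) by blast
  qed simp
qed

section \<open>The bidual\<close>

abbreviation "hom_int_bidual \<equiv> dual_group hom_int_dual hom_int_dual_topology"
abbreviation "hom_int_bidual_topology \<equiv> dual_topology hom_int_dual hom_int_dual_topology"

text \<open>Coordinate \<open>k\<close> goes to the class of \<open>s k / 2\<close>, so these are
  the elements killed by doubling. Arbitrary integer entries are allowed because comparing two
  square roots produces an unreduced sequence \<open>s\<close>.\<close>

definition half_character :: "(nat \<Rightarrow> int) \<Rightarrow> ((nat \<Rightarrow> int) \<Rightarrow> int) \<Rightarrow> real set" where
  "half_character s = character (\<lambda>g. of_int (g s) / 2)"

lemma half_character_in_dual: "half_character s \<in> carrier hom_int_dual"
  using character_in_dual[OF continuous_functional_combination[OF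
        continuous_functional_evaluation continuous_functional_evaluation, of "1/2" s 0 s]]
  by (simp add: half_character_def)

text \<open>Changing \<open>s\<close> by an even sequence changes half the evaluation by an integer.
  So the compact space of \<open>{0, 1}\<close> sequences parametrises all half characters.\<close>

lemma half_character_mod_2: "half_character (\<lambda>i. s i mod 2) = half_character s"
proof
  fix g
  show "half_character (\<lambda>i. s i mod 2) g = half_character s g"
  proof (cases "g \<in> hom_int")
    case True
    have "g s = g (\<lambda>i. s i mod 2 + 2 * (s i div 2))"
      by simp
    also have "\<dots> = g (\<lambda>i. s i mod 2) + 2 * g (\<lambda>i. s i div 2)"
      unfolding hom_intD[OF True] hom_int_scale[OF True] ..
    finally have "of_int (g (\<lambda>i. s i mod 2)) / 2 - of_int (g s) / 2 = (- of_int (g (\<lambda>i. s i div 2)) :: real)"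
      by (simp add: add_divide_distrib)
    then have "circle_proj (of_int (g (\<lambda>i. s i mod 2)) / 2) = circle_proj (of_int (g s) / 2)"
      unfolding circle_proj_eq_iff by (metis Ints_minus Ints_of_int)
    then show ?thesis
      using True by (simp add: half_character_def character_def)
  qed (simp add: half_character_def character_def)
qed

lemma half_character_square: "half_character s \<otimes>\<^bsub>hom_int_dual\<^esub> half_character s = \<one>\<^bsub>hom_int_dual\<^esub>"
proof -
  have "circle_proj (of_int (g s) / 2 + of_int (g s) / 2) = circle_proj 0" for g :: "(nat \<Rightarrow> int) \<Rightarrow> int"
    by (simp add: circle_proj_eq_iff)
  then show ?thesis
    unfolding half_character_def character_mult
    by (simp add: character_def dual_group_def circle_one)
qed

text \<open>Tychonoff's theorem makes the parameter space compact. The parametrisation is continuous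
  because the elements of a compact \<open>K\<close> have a common support bound \<open>n\<close>,
  so the values on \<open>K\<close> depend only on the first \<open>n\<close> entries of
  \<open>s\<close>.\<close>

lemma compactin_half_characters: "compactin hom_int_dual_topology (range half_character)"
proof -
  let ?X = "product_topology (\<lambda>_ :: nat. discrete_topology {0, 1 :: int}) UNIV"
  have top: "topspace ?X = {s. \<forall>i. s i \<in> {0, 1}}"
    by (auto simp: PiE_UNIV_domain)
  have "continuous_map ?X hom_int_dual_topology half_character"
  proof (rule continuous_map_dual_topologyI)
    show "half_character \<in> topspace ?X \<rightarrow> carrier hom_int_dual"
      using half_character_in_dual by blast
    fix K U assume K: "compactin hom_int_topology K" and "openin circle_topology U"
    have K_sub: "K \<subseteq> hom_int"
      using compactin_subset_topspace[OF K] by simp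
    obtain n where n: "\<And>g k. g \<in> K \<Longrightarrow> k \<ge> n \<Longrightarrow> g (unit_seq k) = 0"
      using compactin_hom_int_topology(2)[OF K] by blast
    have local_const: "half_character s g = half_character s' g"
      if "g \<in> K" "\<And>k. k < n \<Longrightarrow> s' k = s k" for s s' g
    proof -
      have g: "g \<in> hom_int"
        using that(1) K_sub by blast
      have "(\<Sum>k<n. g (unit_seq k) * s' k) = (\<Sum>k<n. g (unit_seq k) * s k)"
        using that(2) by (intro sum.cong) auto
      then have "g s' = g s"
        using hom_int_expansion[OF g n[OF that(1)]] by simp
      then show ?thesis
        by (simp add: half_character_def character_def)
    qed
    show "openin ?X {s \<in> topspace ?X. half_character s ` K \<subseteq> U}"
    proof (subst openin_subopen, intro ballI)
      fix s assume s: "s \<in> {s \<in> topspace ?X. half_character s ` K \<subseteq> U}"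
      let ?N = "{s' \<in> topspace ?X. \<forall>k\<in>{..<n}. s' k \<in> {s k}}"
      have "openin ?X {s' \<in> topspace ?X. s' k \<in> {s k}}" for k
      proof (rule openin_continuous_map_preimage)
        show "continuous_map ?X (discrete_topology {0, 1}) (\<lambda>s. s k)"
          by (rule continuous_map_product_projection) simp
        show "openin (discrete_topology {0, 1}) {s k}"
          using s unfolding top by simp
      qed
      \<comment> \<open>The intersection with the whole space covers \<open>n = 0\<close>, where the
        indexed intersection is empty and would be the universe of the type.\<close>
      then have "openin ?X ((\<Inter>k\<in>{..<n}. {s' \<in> topspace ?X. s' k \<in> {s k}}) \<inter> topspace ?X)"
        by (intro openin_INT) auto
      moreover have "(\<Inter>k\<in>{..<n}. {s' \<in> topspace ?X. s' k \<in> {s k}}) \<inter> topspace ?X = ?N"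
        by blast
      ultimately have "openin ?X ?N"
        by simp
      moreover have "half_character s' ` K \<subseteq> U" if "s' \<in> ?N" for s'
      proof -
        have "half_character s' g = half_character s g" if "g \<in> K" for g
          using local_const[OF that, of s' s] \<open>s' \<in> ?N\<close> by simp
        then show ?thesis
          using s by auto
      qed
      moreover have "s \<in> ?N"
        using s by simp
      ultimately show "\<exists>N. openin ?X N \<and> s \<in> N \<and> N \<subseteq> {s \<in> topspace ?X. half_character s ` K \<subseteq> U}"
        by (intro exI[of _ ?N]) auto
    qed
  qed
  moreover have "compact_space ?X"
    by (simp add: compact_space_product_topology compact_space_discrete_topology)
  ultimately have "compactin hom_int_dual_topology (half_character ` topspace ?X)"
    by (intro image_compactin[of ?X]) (simp_all add: compact_space_def)
  moreover have "half_character ` topspace ?X = range half_character"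
  proof
    show "range half_character \<subseteq> half_character ` topspace ?X"
    proof
      fix c assume "c \<in> range half_character"
      then obtain s where "c = half_character s" by blast
      moreover have "(\<lambda>i. s i mod 2) \<in> topspace ?X"
        unfolding top by (auto simp: mod_2_eq_odd)
      ultimately show "c \<in> half_character ` topspace ?X"
        using half_character_mod_2 by (metis imageI)
    qed
  qed blast
  ultimately show ?thesis
    by simp
qed

text \<open>The only element of order two in the circle is the class of 1/2, which lies outside this
  arc.\<close>

lemma circle_small_involution:
  assumes z: "z \<in> circle_arc 0 (1/4)" and "z \<otimes>\<^bsub>circle_group\<^esub> z = circle_proj 0"
  shows "z = circle_proj 0"
proof -
  obtain y where y: "z = circle_proj y" "\<bar>y - 0\<bar> < 1/4"
    using z by (rule circle_arcE)
  then obtain m where m: "y + y = of_int m"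
    using assms(2) by (auto simp: circle_mult circle_proj_eq_iff elim: Ints_cases)
  then have "\<bar>of_int m :: real\<bar> < 1"
    using y(2) by linarith
  then have "m = 0" by linarith
  then show ?thesis using m y(1) by simp
qed

lemma dual_one_closed: "\<one>\<^bsub>hom_int_dual\<^esub> \<in> carrier hom_int_dual"
  using dual_closed[OF half_character_in_dual[of "\<lambda>_. 0"] half_character_in_dual[of "\<lambda>_. 0"]] by (simp add: half_character_square)

lemma bidual_one: assumes "\<phi> \<in> carrier hom_int_bidual" shows "\<phi> \<one>\<^bsub>hom_int_dual\<^esub> = circle_proj 0"
proof -
  have hom: "\<phi> \<in> hom hom_int_dual circle_group"
    using assms by (simp add: carrier_dual_group_iff)
  obtain x where x: "\<phi> \<one>\<^bsub>hom_int_dual\<^esub> = circle_proj x"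
    using hom_in_carrier[OF hom dual_one_closed] by (rule circle_projE)
  have "\<one>\<^bsub>hom_int_dual\<^esub> \<otimes>\<^bsub>hom_int_dual\<^esub> \<one>\<^bsub>hom_int_dual\<^esub> = \<one>\<^bsub>hom_int_dual\<^esub>"
    by (intro ext) (simp add: dual_group_def circle_one circle_mult)
  then have "circle_proj x = circle_proj (x + x)"
    using hom_mult[OF hom dual_one_closed dual_one_closed] by (simp add: x circle_mult)
  then show ?thesis
    by (simp add: x circle_proj_eq_iff)
qed

section \<open>Characters of the dual that are small on the kernel of doubling\<close>

context
  fixes \<phi> assumes \<phi>: "\<phi> \<in> carrier hom_int_bidual"
    and small: "\<phi> ` range half_character \<subseteq> circle_arc 0 (1/4)"
begin

lemma bidual_hom: "\<phi> \<in> hom hom_int_dual circle_group"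
  using \<phi> by (simp add: carrier_dual_group_iff)

lemma bidual_half_character: "\<phi> (half_character s) = circle_proj 0"
proof (rule circle_small_involution)
  show "\<phi> (half_character s) \<in> circle_arc 0 (1/4)"
    using small by blast
  have "\<phi> (half_character s) \<otimes>\<^bsub>circle_group\<^esub> \<phi> (half_character s) =
      \<phi> (half_character s \<otimes>\<^bsub>hom_int_dual\<^esub> half_character s)"
    by (rule hom_mult[OF bidual_hom half_character_in_dual half_character_in_dual, symmetric])
  then show "\<phi> (half_character s) \<otimes>\<^bsub>circle_group\<^esub> \<phi> (half_character s) = circle_proj 0"
    by (simp add: half_character_square bidual_one[OF \<phi>])
qed

text \<open>Two square roots differ by an element of order two of the dual, that is by a half character.\<close>

lemma bidual_square_root_unique:
  assumes d: "d \<in> carrier hom_int_dual" and e: "e \<in> carrier hom_int_dual"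
    and eq: "d \<otimes>\<^bsub>hom_int_dual\<^esub> d = e \<otimes>\<^bsub>hom_int_dual\<^esub> e"
  shows "\<phi> d = \<phi> e"
proof -
  obtain x where x: "\<And>k. d (\<lambda>a. a k) = circle_proj (x k)"
    using d by (rule dual_coordinates) blast
  obtain y where y: "\<And>k. e (\<lambda>a. a k) = circle_proj (y k)"
    using e by (rule dual_coordinates) blast
  have "\<exists>m. x k + x k - (y k + y k) = of_int m" for k
  proof -
    have "circle_proj (x k + x k) = circle_proj (y k + y k)"
      using dual_mult_coordinate[of d d k] dual_mult_coordinate[of e e k] eq by (simp add: x y circle_mult)
    then show ?thesis
      by (auto simp: circle_proj_eq_iff elim: Ints_cases)
  qed
  then obtain s where s: "\<And>k. x k + x k - (y k + y k) = of_int (s k)"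
    by metis
  have "d = e \<otimes>\<^bsub>hom_int_dual\<^esub> half_character s"
  proof (rule dual_eqI[OF d dual_closed[OF e half_character_in_dual]])
    fix k
    have "x k = y k + of_int (s k) / 2"
      using s[of k] by simp
    then show "d (\<lambda>a. a k) = (e \<otimes>\<^bsub>hom_int_dual\<^esub> half_character s) (\<lambda>a. a k)"
      unfolding dual_mult_coordinate
      by (simp add: x y half_character_def character_def hom_int_coordinate circle_mult)
  qed
  then have "\<phi> d = \<phi> e \<otimes>\<^bsub>circle_group\<^esub> circle_proj 0"
    using hom_mult[OF bidual_hom e half_character_in_dual] by (simp add: bidual_half_character)
  moreover have "\<phi> e \<in> carrier circle_group"
    by (rule hom_in_carrier[OF bidual_hom e])
  ultimately show ?thesis
    by (auto elim!: circle_projE simp: circle_mult)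
qed

lemma bidual_is_square: "\<exists>\<psi>\<in>carrier hom_int_bidual. \<phi> = \<psi> \<otimes>\<^bsub>hom_int_bidual\<^esub> \<psi>"
proof -
  let ?D = "carrier hom_int_dual"
  \<comment> \<open>With \<open>n = 0\<close> no coordinate is prescribed. The chosen root
    \<open>h\<close> need be neither multiplicative nor continuous; \<open>\<psi>\<close> inherits
    both properties only because \<open>\<phi>\<close> takes the same value at all square roots of
    an element.\<close>
  have "\<forall>d. \<exists>e. d \<in> ?D \<longrightarrow> e \<in> ?D \<and> e \<otimes>\<^bsub>hom_int_dual\<^esub> e = d"
    using dual_square_root[where n = 0] by (metis less_zeroE)
  from choice[OF this] obtain h
    where h: "\<And>d. d \<in> ?D \<Longrightarrow> h d \<in> ?D" "\<And>d. d \<in> ?D \<Longrightarrow> h d \<otimes>\<^bsub>hom_int_dual\<^esub> h d = d"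
    by blast
  define \<psi> where "\<psi> = (\<lambda>d\<in>?D. \<phi> (h d))"
  have \<psi>: "\<psi> d = \<phi> e" if "e \<in> ?D" "e \<otimes>\<^bsub>hom_int_dual\<^esub> e = d" for d e
  proof -
    have d: "d \<in> ?D"
      using dual_closed[OF that(1) that(1)] that(2) by simp
    have "\<phi> (h d) = \<phi> e"
      by (rule bidual_square_root_unique) (simp_all add: h d that)
    then show ?thesis
      using d by (simp add: \<psi>_def)
  qed
  have \<psi>_closed: "\<psi> d \<in> carrier circle_group" if "d \<in> ?D" for d
    using hom_in_carrier[OF bidual_hom h(1)[OF that]] that by (simp add: \<psi>_def)
  have "\<psi> \<in> hom hom_int_dual circle_group"
  proof (rule homI)
    fix d e assume de: "d \<in> ?D" "e \<in> ?D"
    have "\<psi> (d \<otimes>\<^bsub>hom_int_dual\<^esub> e) = \<phi> (h d \<otimes>\<^bsub>hom_int_dual\<^esub> h e)"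
      using de by (intro \<psi>) (simp_all add: dual_closed dual_square_mult h)
    also have "\<dots> = \<phi> (h d) \<otimes>\<^bsub>circle_group\<^esub> \<phi> (h e)"
      by (rule hom_mult[OF bidual_hom h(1)[OF de(1)] h(1)[OF de(2)]])
    finally show "\<psi> (d \<otimes>\<^bsub>hom_int_dual\<^esub> e) = \<psi> d \<otimes>\<^bsub>circle_group\<^esub> \<psi> e"
      using de by (simp add: \<psi>_def)
  qed (rule \<psi>_closed)
  moreover have "continuous_map hom_int_dual_topology circle_topology \<psi>"
    unfolding continuous_map_def
  proof (intro conjI allI impI)
    show "\<psi> \<in> topspace hom_int_dual_topology \<rightarrow> topspace circle_topology"
      using \<psi>_closed by (simp add: topspace_dual_topology topspace_circle_topology)
    fix U assume U: "openin circle_topology U"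
    have "continuous_map hom_int_dual_topology circle_topology \<phi>"
      using \<phi> by (simp add: carrier_dual_group_iff)
    from openin_continuous_map_preimage[OF this U]
    have M: "openin hom_int_dual_topology {e \<in> ?D. \<phi> e \<in> U}"
      by (simp add: topspace_dual_topology)
    show "openin hom_int_dual_topology {d \<in> topspace hom_int_dual_topology. \<psi> d \<in> U}"
      unfolding topspace_dual_topology
    proof (subst openin_subopen, intro ballI)
      fix d assume "d \<in> {d \<in> ?D. \<psi> d \<in> U}"
      then have d: "d \<in> ?D" and hd: "h d \<in> {e \<in> ?D. \<phi> e \<in> U}"
        using h(1) by (auto simp: \<psi>_def)
      obtain t where t: "\<And>k. h d (\<lambda>a. a k) = circle_proj (t k)"
        using h(1)[OF d] by (rule dual_coordinates) blast
      obtain n \<epsilon> where \<epsilon>: "\<epsilon> > 0" "dual_box t n \<epsilon> \<subseteq> {e \<in> ?D. \<phi> e \<in> U}"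
        using dual_box_subset_open[OF M hd t] by blast
      \<comment> \<open>Both the centre and the radius are doubled, so halving the representatives
        \<open>u k\<close> leads back into the box around \<open>h d\<close>. A root of
        \<open>e\<close> with exactly these halves replaces \<open>h e\<close>, whose coordinates
        are out of control.\<close>
      let ?N = "dual_box (\<lambda>k. 2 * t k) n (2 * \<epsilon>)"
      have "d (\<lambda>a. a k) = circle_proj (2 * t k)" for k
        using dual_mult_coordinate[of "h d" "h d" k] h(2)[OF d] by (simp add: t circle_mult)
      then have "d \<in> ?N"
        using d \<epsilon>(1) by (simp add: dual_box_def circle_proj_in_arc)
      moreover have "\<psi> e \<in> U" if e: "e \<in> ?N" for e
      proof -
        obtain u where u: "\<And>k. k < n \<Longrightarrow> e (\<lambda>a. a k) = circle_proj (u k)"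
          "\<And>k. k < n \<Longrightarrow> \<bar>u k - 2 * t k\<bar> < 2 * \<epsilon>"
          using e by (rule dual_box_coordinates) blast
        have "e \<in> ?D"
          using e by (simp add: dual_box_def)
        moreover have "e (\<lambda>a. a k) = circle_proj (2 * (u k / 2))" if "k < n" for k
          using u(1)[OF that] by simp
        ultimately obtain f where f: "f \<in> ?D" "f \<otimes>\<^bsub>hom_int_dual\<^esub> f = e"
          "\<And>k. k < n \<Longrightarrow> f (\<lambda>a. a k) = circle_proj (u k / 2)"
          using dual_square_root[of e n "\<lambda>k. u k / 2"] by blast
        have "f (\<lambda>a. a k) \<in> circle_arc (t k) \<epsilon>" if "k < n" for k
        proof -
          have "\<bar>u k / 2 - t k\<bar> < \<epsilon>"
            using u(2)[OF that] by linarith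
          then show ?thesis
            unfolding f(3)[OF that] by (rule circle_proj_in_arc)
        qed
        then have "f \<in> dual_box t n \<epsilon>"
          using f(1) by (simp add: dual_box_def)
        then show ?thesis
          using \<epsilon>(2) \<psi>[OF f(1,2)] by auto
      qed
      then have "?N \<subseteq> {d \<in> ?D. \<psi> d \<in> U}"
        by (auto simp: dual_box_def)
      ultimately show "\<exists>N. openin hom_int_dual_topology N \<and> d \<in> N \<and> N \<subseteq> {d \<in> ?D. \<psi> d \<in> U}"
        using openin_dual_box by blast
    qed
  qed
  ultimately have "\<psi> \<in> carrier hom_int_bidual"
    by (simp add: carrier_dual_group_iff) (simp add: \<psi>_def)
  moreover have "\<phi> d = (\<psi> \<otimes>\<^bsub>hom_int_bidual\<^esub> \<psi>) d" for d
  proof (cases "d \<in> ?D")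
    case True
    have "\<phi> (h d \<otimes>\<^bsub>hom_int_dual\<^esub> h d) = \<phi> (h d) \<otimes>\<^bsub>circle_group\<^esub> \<phi> (h d)"
      by (rule hom_mult[OF bidual_hom h(1)[OF True] h(1)[OF True]])
    then show ?thesis
      unfolding dual_group_mult[where \<phi> = \<psi>] using True by (simp add: h \<psi>_def)
  next
    case False
    have "\<phi> \<in> extensional ?D"
      using \<phi> by (simp add: carrier_dual_group_iff[where H = hom_int_dual])
    then have "\<phi> d = undefined"
      using False by (rule extensional_arb)
    then show ?thesis
      unfolding dual_group_mult[where \<phi> = \<psi>] using False by simp
  qed
  ultimately show ?thesis
    by blast
qed

end

text \<open>The bound \<open>N\<close> is there for the induction: it provides a second solution
  \<open>h\<close> whose support begins beyond that of the first solution \<open>g\<close>, so that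
  the two are independent and can be combined to satisfy one more linear condition.\<close>

lemma annihilator_nonzero:
  assumes "finite F"
  shows "\<exists>g\<in>hom_int. (\<forall>a\<in>F. g a = 0) \<and> (\<exists>k. g (unit_seq k) \<noteq> 0) \<and> (\<forall>k<N. g (unit_seq k) = 0)"
  using assms
proof (induction F arbitrary: N rule: finite_induct)
  case empty
  show ?case
    by (rule bexI[OF _ hom_int_coordinate[of N]]) (auto simp: unit_seq_def)
next
  case (insert a F)
  obtain g where g: "g \<in> hom_int" "\<forall>a\<in>F. g a = 0" "\<exists>k. g (unit_seq k) \<noteq> 0" "\<forall>k<N. g (unit_seq k) = 0"
    using insert.IH[of N] by blast
  obtain M where M: "\<And>k. k \<ge> M \<Longrightarrow> g (unit_seq k) = 0"
    using pointwise_bounded_hom_int_support[of "{g}"] g(1) by auto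
  obtain h where h: "h \<in> hom_int" "\<forall>a\<in>F. h a = 0" "\<exists>k. h (unit_seq k) \<noteq> 0"
    "\<forall>k<max M N. h (unit_seq k) = 0"
    using insert.IH[of "max M N"] by blast
  show ?case
  proof (cases "h a = 0")
    case True
    then show ?thesis
      using h by (intro bexI[OF _ h(1)]) auto
  next
    case False
    \<comment> \<open>The combination that cancels at \<open>a\<close>. On the support of
      \<open>g\<close> the function \<open>h\<close> vanishes, so a nonzero coordinate of
      \<open>g\<close> survives, multiplied by \<open>h a\<close>.\<close>
    let ?f = "\<lambda>b. h a * g b - g a * h b"
    have f: "?f \<in> hom_int"
      by (intro hom_int_minus hom_int_cmult g(1) h(1))
    obtain k where k: "g (unit_seq k) \<noteq> 0"
      using g(3) by blast
    then have "k < M"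
      using M[of k] by (cases "k < M") auto
    then have "?f (unit_seq k) \<noteq> 0"
      using h(4) k False by simp
    then have "\<exists>k. ?f (unit_seq k) \<noteq> 0" ..
    moreover have "\<forall>b\<in>insert a F. ?f b = 0" "\<forall>k<N. ?f (unit_seq k) = 0"
      using g(2,4) h(2,4) by simp_all
    ultimately show ?thesis
      by (intro bexI[OF _ f] conjI)
  qed
qed

text \<open>Half of an element of the annihilator of \<open>F\<close> again annihilates
  \<open>F\<close>, because the integers have no torsion. So the halving can be repeated forever,
  and every value would be divisible by all powers of two.\<close>

lemma squares_not_neighbourhood:
  assumes U: "openin hom_int_topology U" "(\<lambda>_. 0) \<in> U"
  shows "\<not> U \<subseteq> {\<lambda>a. g a + g a | g. g \<in> hom_int}"
proof
  assume sub: "U \<subseteq> {\<lambda>a. g a + g a | g. g \<in> hom_int}"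
  obtain F where F: "finite F" "{h \<in> hom_int. \<forall>a\<in>F. h a = 0} \<subseteq> U"
    using U unfolding openin_hom_int_topology by meson
  obtain g k where g: "g \<in> hom_int" "\<forall>a\<in>F. g a = 0" and k: "g (unit_seq k) \<noteq> 0"
    using annihilator_nonzero[OF F(1)] by blast
  have "\<exists>h\<in>hom_int. (\<forall>a\<in>F. h a = 0) \<and> g = (\<lambda>a. 2 ^ n * h a)" for n :: nat
  proof (induction n)
    case 0
    then show ?case using g by auto
  next
    case (Suc n)
    then obtain h where h: "h \<in> hom_int" "\<forall>a\<in>F. h a = 0" "g = (\<lambda>a. 2 ^ n * h a)"
      by blast
    then have "h \<in> {\<lambda>a. g a + g a | g. g \<in> hom_int}"
      using F(2) sub by blast
    then obtain f where "f \<in> hom_int" "h = (\<lambda>a. f a + f a)"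
      by blast
    then show ?case
      using h(2,3) by (intro bexI[of _ f]) auto
  qed
  then have "2 ^ n dvd g (unit_seq k)" for n
    by (metis dvd_triv_left)
  then show False
    using eq_0_if_powers_dvd[of 2] k by auto
qed

lemma not_reflexive_hom_int_group: "\<not> reflexive_group hom_int_group hom_int_topology"
proof
  assume "reflexive_group hom_int_group hom_int_topology"
  then obtain f where f: "f \<in> iso hom_int_bidual hom_int_group"
    and homeo: "homeomorphic_map hom_int_bidual_topology hom_int_topology f"
    unfolding reflexive_group_def topologically_isomorphic_def by blast
  have hom: "f \<in> hom hom_int_bidual hom_int_group"
    using f by (simp add: iso_def)
  let ?O = "{\<phi> \<in> carrier hom_int_bidual. \<phi> ` range half_character \<subseteq> circle_arc 0 (1/4)}"
  let ?one = "\<lambda>d\<in>carrier hom_int_dual. circle_proj 0"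
  have "openin hom_int_bidual_topology ?O"
    by (rule openin_dual_topology_subbase[OF compactin_half_characters openin_circle_arc])
  then have open_image: "openin hom_int_topology (f ` ?O)"
    by (subst homeomorphic_map_openness[OF homeo]) (auto simp: topspace_dual_topology)
  have "?one \<in> hom hom_int_dual circle_group"
    by (rule homI) (simp_all add: dual_closed circle_mult)
  moreover have "continuous_map hom_int_dual_topology circle_topology ?one"
    by (rule continuous_map_eq[of _ _ "\<lambda>_. circle_proj 0"])
      (simp_all add: topspace_dual_topology topspace_circle_topology)
  ultimately have one: "?one \<in> carrier hom_int_bidual"
    by (simp add: carrier_dual_group_iff)
  moreover have "?one (half_character s) \<in> circle_arc 0 (1/4)" for s
    by (simp add: half_character_in_dual circle_proj_in_arc)
  ultimately have "?one \<in> ?O"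
    by blast
  then have "f ?one \<in> f ` ?O"
    by (rule imageI)
  moreover have "f ?one = (\<lambda>_. 0)"
  proof -
    have "?one \<otimes>\<^bsub>hom_int_bidual\<^esub> ?one = ?one"
      unfolding dual_group_mult by (intro ext) (simp add: circle_mult)
    then have "f ?one = (\<lambda>a. f ?one a + f ?one a)"
      using hom_mult[OF hom one one] by simp
    from fun_cong[OF this] have "f ?one a = 0" for a
      by (metis add_cancel_right_right)
    then show ?thesis ..
  qed
  ultimately have "(\<lambda>_. 0) \<in> f ` ?O"
    by (simp only:)
  \<comment> \<open>Homomorphisms carry doubles to doubles, so the open image consists of doubles
    whichever isomorphism \<open>f\<close> is.\<close>
  moreover have "f ` ?O \<subseteq> {\<lambda>a. g a + g a | g. g \<in> hom_int}"
  proof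
    fix x assume "x \<in> f ` ?O"
    then obtain \<phi> where "\<phi> \<in> carrier hom_int_bidual" "\<phi> ` range half_character \<subseteq> circle_arc 0 (1/4)"
      and x: "x = f \<phi>"
      by blast
    then obtain \<psi> where \<psi>: "\<psi> \<in> carrier hom_int_bidual" "\<phi> = \<psi> \<otimes>\<^bsub>hom_int_bidual\<^esub> \<psi>"
      using bidual_is_square by blast
    have "x = (\<lambda>a. f \<psi> a + f \<psi> a)"
      unfolding x \<psi>(2) using hom_mult[OF hom \<psi>(1) \<psi>(1)] by simp
    moreover have "f \<psi> \<in> hom_int"
      using hom_in_carrier[OF hom \<psi>(1)] by simp
    ultimately show "x \<in> {\<lambda>a. g a + g a | g. g \<in> hom_int}"
      by blast
  qed
  ultimately show False
    using squares_not_neighbourhood[OF open_image] by blast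
qed

section \<open>The inverse system of restrictions\<close>

abbreviation "finite_subsets \<equiv> {F :: (nat \<Rightarrow> int) set. finite F}"
abbreviation "finite_inclusion \<equiv> {(E, F :: (nat \<Rightarrow> int) set). finite F \<and> E \<subseteq> F}"
abbreviation "restriction_group F \<equiv> pointwise_group (cut_off F ` hom_int)"
abbreviation "restriction_map E F \<equiv> cut_off E"
abbreviation "limit_group \<equiv>
  inverse_limit_group finite_subsets finite_inclusion restriction_group restriction_map"
abbreviation "limit_topology \<equiv>
  inverse_limit_topology finite_subsets finite_inclusion restriction_group restriction_map"

lemma cut_off_cut_off: "E \<subseteq> F \<Longrightarrow> cut_off E (cut_off F g) = cut_off E g"
  unfolding cut_off_def by (intro ext) auto

lemma cut_off_add: "cut_off F (\<lambda>a. g a + h a) = (\<lambda>a. cut_off F g a + cut_off F h a)"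
  unfolding cut_off_def by (intro ext) auto

lemma cut_off_eqD: "cut_off F g = cut_off F h \<Longrightarrow> a \<in> F \<Longrightarrow> g a = h a"
  unfolding cut_off_def by (metis (full_types))

lemma inverse_system_restrictions:
  "inverse_system finite_subsets finite_inclusion restriction_group restriction_map"
  unfolding inverse_system_def
proof (intro conjI ballI allI impI)
  show "directed_set finite_subsets finite_inclusion"
    unfolding directed_set_def partial_order_on_def preorder_on_def
  proof (intro conjI ballI)
    show "\<exists>K\<in>finite_subsets. (E, K) \<in> finite_inclusion \<and> (F, K) \<in> finite_inclusion"
      if "E \<in> finite_subsets" "F \<in> finite_subsets" for E F
      using that by (intro bexI[of _ "E \<union> F"]) auto
  qed (auto simp: refl_on_def trans_def antisym_def intro: finite_subset)
  show "group (restriction_group F)" for F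
    using comm_group_pointwise_group[OF additive_subgroup_cut] by (rule comm_group.axioms(2))
  show "case q of (E, F) \<Rightarrow> cut_off E \<in> hom (restriction_group F) (restriction_group E)"
    if "q \<in> finite_inclusion" for q
    using that by (auto simp: hom_def cut_off_cut_off cut_off_add)
  show "cut_off F x = x" if "x \<in> carrier (restriction_group F)" for F x
    using that by (auto simp: cut_off_cut_off)
  show "cut_off E (cut_off F x) = cut_off E x" if "(E, F) \<in> finite_inclusion" for E F x
    using that by (simp add: cut_off_cut_off)
qed

lemma limit_groupD:
  assumes "x \<in> carrier limit_group"
  shows "finite F \<Longrightarrow> x F \<in> cut_off F ` hom_int"
    and "finite F \<Longrightarrow> E \<subseteq> F \<Longrightarrow> cut_off E (x F) = x E"
    and "x \<in> extensional finite_subsets"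
  using assms by (auto simp: inverse_limit_group_def PiE_def Pi_iff)

lemma limit_group_mult:
  "x \<otimes>\<^bsub>limit_group\<^esub> y = (\<lambda>F\<in>finite_subsets. \<lambda>a. x F a + y F a)"
  by (simp add: inverse_limit_group_def product_group_def)

section \<open>Identification of the limit with the homomorphisms\<close>

definition to_limit :: "((nat \<Rightarrow> int) \<Rightarrow> int) \<Rightarrow> (nat \<Rightarrow> int) set \<Rightarrow> (nat \<Rightarrow> int) \<Rightarrow> int" where
  "to_limit g = (\<lambda>F\<in>finite_subsets. cut_off F g)"

text \<open>By compatibility the components at singletons determine the whole family.\<close>

definition from_limit :: "((nat \<Rightarrow> int) set \<Rightarrow> (nat \<Rightarrow> int) \<Rightarrow> int) \<Rightarrow> (nat \<Rightarrow> int) \<Rightarrow> int" where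
  "from_limit x = (\<lambda>a. x {a} a)"

lemma to_limit_carrier: "g \<in> hom_int \<Longrightarrow> to_limit g \<in> carrier limit_group"
  by (auto simp: inverse_limit_group_def to_limit_def cut_off_cut_off dest: finite_subset)

lemma from_limit_cut_off:
  assumes x: "x \<in> carrier limit_group" and F: "finite F"
  shows "x F = cut_off F (from_limit x)"
proof
  fix a
  obtain g where g: "x F = cut_off F g"
    using limit_groupD(1)[OF x F] by blast
  show "x F a = cut_off F (from_limit x) a"
  proof (cases "a \<in> F")
    case True
    then have "cut_off {a} (x F) = x {a}"
      by (intro limit_groupD(2)[OF x F]) simp
    from fun_cong[OF this, of a] show ?thesis
      using True by (simp add: from_limit_def cut_off_def)
  qed (simp add: g cut_off_def)
qed

text \<open>Additivity at \<open>a\<close> and \<open>b\<close> concerns three sequences only, and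
  the component at a finite set containing them is the restriction of a genuine
  homomorphism.\<close>

lemma from_limit_hom_int:
  assumes x: "x \<in> carrier limit_group"
  shows "from_limit x \<in> hom_int"
  unfolding hom_int_def
proof (intro CollectI allI)
  fix a b :: "nat \<Rightarrow> int"
  let ?F = "{a, b, \<lambda>i. a i + b i}"
  obtain g where g: "g \<in> hom_int" "x ?F = cut_off ?F g"
    using limit_groupD(1)[OF x, of ?F] by auto
  have "from_limit x c = g c" if "c \<in> ?F" for c
    using from_limit_cut_off[OF x, of ?F] g(2) that by (intro cut_off_eqD[of ?F]) simp_all
  then show "from_limit x (\<lambda>i. a i + b i) = from_limit x a + from_limit x b"
    using hom_intD[OF g(1)] by simp
qed

lemma to_limit_from_limit:
  assumes x: "x \<in> carrier limit_group"
  shows "to_limit (from_limit x) = x"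
proof
  fix F
  show "to_limit (from_limit x) F = x F"
    using from_limit_cut_off[OF x] extensional_arb[OF limit_groupD(3)[OF x]]
    by (cases "finite F") (simp_all add: to_limit_def)
qed

lemma from_limit_to_limit: "from_limit (to_limit g) = g"
  by (simp add: from_limit_def to_limit_def cut_off_def)

lemma to_limit_add: "to_limit (\<lambda>a. g a + h a) = to_limit g \<otimes>\<^bsub>limit_group\<^esub> to_limit h"
  unfolding limit_group_mult by (auto simp: to_limit_def cut_off_add)

lemma from_limit_mult: "from_limit (x \<otimes>\<^bsub>limit_group\<^esub> y) = (\<lambda>a. from_limit x a + from_limit y a)"
  by (simp add: from_limit_def limit_group_mult)

lemma limit_group_closed:
  assumes "x \<in> carrier limit_group" "y \<in> carrier limit_group"
  shows "x \<otimes>\<^bsub>limit_group\<^esub> y \<in> carrier limit_group"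
proof -
  have "x \<otimes>\<^bsub>limit_group\<^esub> y = to_limit (\<lambda>a. from_limit x a + from_limit y a)"
    using to_limit_add[of "from_limit x" "from_limit y"] assms by (simp add: to_limit_from_limit)
  then show ?thesis
    using assms by (simp add: to_limit_carrier hom_int_add from_limit_hom_int)
qed

lemma continuous_map_to_limit: "continuous_map hom_int_topology limit_topology to_limit"
  unfolding inverse_limit_topology_def continuous_map_in_subtopology
proof
  have "continuous_map hom_int_topology (discrete_topology (cut_off F ` hom_int)) (cut_off F)"
    if "finite F" for F
    unfolding continuous_map_def
  proof (intro conjI allI impI)
    fix U
    show "openin hom_int_topology {g \<in> topspace hom_int_topology. cut_off F g \<in> U}"
      unfolding openin_hom_int_topology
    proof (intro conjI ballI exI)
      fix g assume g: "g \<in> {g \<in> topspace hom_int_topology. cut_off F g \<in> U}"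
      show "{h \<in> hom_int. \<forall>a\<in>F. h a = g a} \<subseteq> {g \<in> topspace hom_int_topology. cut_off F g \<in> U}"
      proof
        fix h assume h: "h \<in> {h \<in> hom_int. \<forall>a\<in>F. h a = g a}"
        then have "cut_off F h = cut_off F g"
          unfolding cut_off_def by (intro ext) simp
        then show "h \<in> {g \<in> topspace hom_int_topology. cut_off F g \<in> U}"
          using g h by simp
      qed
    qed (use \<open>finite F\<close> in auto)
  qed auto
  moreover have "to_limit g F = cut_off F g" if "finite F" for g F
    using that by (simp add: to_limit_def)
  ultimately show "continuous_map hom_int_topology
      (product_topology (\<lambda>F. discrete_topology (carrier (restriction_group F))) finite_subsets) to_limit"
    unfolding continuous_map_componentwise by (auto simp: to_limit_def)
  show "to_limit \<in> topspace hom_int_topology \<rightarrow> carrier limit_group"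
    using to_limit_carrier by auto
qed

text \<open>A basic neighbourhood prescribes values on one finite \<open>F\<close>. These are
  encoded in the single component at \<open>F\<close>, and fixing that component is an open
  condition because the factor is discrete.\<close>

lemma continuous_map_from_limit: "continuous_map limit_topology hom_int_topology from_limit"
  unfolding continuous_map_def topspace_inverse_limit_topology
proof (intro conjI allI impI)
  show "from_limit \<in> carrier limit_group \<rightarrow> topspace hom_int_topology"
    using from_limit_hom_int by simp
  fix U assume U: "openin hom_int_topology U"
  show "openin limit_topology {x \<in> carrier limit_group. from_limit x \<in> U}"
  proof (subst openin_subopen, intro ballI)
    fix x assume x: "x \<in> {x \<in> carrier limit_group. from_limit x \<in> U}"
    then have "from_limit x \<in> U" by simp
    with U obtain F where F: "finite F" "{h \<in> hom_int. \<forall>a\<in>F. h a = from_limit x a} \<subseteq> U"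
      unfolding openin_hom_int_topology by meson
    let ?N = "{y \<in> topspace limit_topology. y F \<in> {x F}}"
    have "continuous_map limit_topology (discrete_topology (carrier (restriction_group F))) (\<lambda>y. y F)"
      unfolding inverse_limit_topology_def
      using F(1) by (intro continuous_map_from_subtopology continuous_map_product_projection) simp
    then have "openin limit_topology ?N"
      using x F(1) limit_groupD(1)[of x F] by (intro openin_continuous_map_preimage) auto
    moreover have "from_limit y \<in> U" if y: "y \<in> ?N" for y
    proof -
      have y_carrier: "y \<in> carrier limit_group" and "y F = x F"
        using y by (simp_all add: topspace_inverse_limit_topology)
      then have "cut_off F (from_limit y) = cut_off F (from_limit x)"
        using x F(1) from_limit_cut_off[of y F] from_limit_cut_off[of x F] by simp
      then have "from_limit y a = from_limit x a" if "a \<in> F" for a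
        using that by (rule cut_off_eqD)
      then have "from_limit y \<in> {h \<in> hom_int. \<forall>a\<in>F. h a = from_limit x a}"
        using from_limit_hom_int[OF y_carrier] by simp
      with F(2) show ?thesis ..
    qed
    then have "?N \<subseteq> {x \<in> carrier limit_group. from_limit x \<in> U}"
      by (auto simp: topspace_inverse_limit_topology)
    moreover have "x \<in> ?N"
      using x by (simp add: topspace_inverse_limit_topology)
    ultimately show "\<exists>N. openin limit_topology N \<and> x \<in> N \<and>
        N \<subseteq> {x \<in> carrier limit_group. from_limit x \<in> U}"
      by blast
  qed
qed

lemma limit_group_isomorphisms:
  "topological_group_isomorphisms limit_group limit_topology hom_int_group hom_int_topology
     from_limit to_limit"
  unfolding topological_group_isomorphisms_def homeomorphic_maps_def
  by (intro conjI homI ballI continuous_map_from_limit continuous_map_to_limit)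
    (simp_all add: topspace_inverse_limit_topology from_limit_hom_int to_limit_carrier
      from_limit_mult to_limit_add to_limit_from_limit from_limit_to_limit)

theorem corollary3p7:
  shows "\<exists>(I :: (nat \<Rightarrow> int) set set) r
            (G :: (nat \<Rightarrow> int) set \<Rightarrow> ((nat \<Rightarrow> int) \<Rightarrow> int) monoid) p.
           inverse_system I r G p \<and>
           (\<forall>i\<in>I. finitely_generated_group (G i) \<and> free_abelian (G i)) \<and>
           \<not> reflexive_group (inverse_limit_group I r G p) (inverse_limit_topology I r G p)"
proof (intro exI conjI ballI)
  show "inverse_system finite_subsets finite_inclusion restriction_group restriction_map"
    by (rule inverse_system_restrictions)
  show "finitely_generated_group (restriction_group F)" "free_abelian (restriction_group F)"
    if "F \<in> finite_subsets" for F
    using that exists_int_basis_cut[of F] finitely_generated_pointwise_group[OF additive_subgroup_cut]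
      free_abelian_pointwise_group[OF additive_subgroup_cut] by auto
  show "\<not> reflexive_group limit_group limit_topology"
  proof
    assume "reflexive_group limit_group limit_topology"
    then have "reflexive_group hom_int_group hom_int_topology"
      by (rule reflexive_group_transfer[OF limit_group_isomorphisms limit_group_closed,
            rotated -1]) (simp_all add: hom_int_add topspace_inverse_limit_topology)
    then show False
      using not_reflexive_hom_int_group by blast
  qed
qed

end
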